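(* Let $K=b(p,q)$ be a rational ($2$-bridge) knot, with $p>q>0$, $\gcd(p,q)=1$, $q$ even, and let $k_1,\dots,k_{2n}$ be nonzero integers such that $p/q=[2k_1,2k_2,\ldots,2k_{2n}]$. Then, up to multiplication by a unit $\pm t^{j}$ of $\mathbb{Z}[t,t^{-1}]$, the Alexander polynomial of $K$ is $$ \Delta_K(t)=K_{2n}\big([2]_{-t}k_1,\,-[2]_{-t^{-1}}k_2,\,\ldots,\,[2]_{-t}k_{2n-1},\,-[2]_{-t^{-1}}k_{2n}\big), $$ where $K_{2n}(x_1,\ldots,x_{2n})$ is the continuant, i.e. the determinant of the $2n\times 2n$ tridiagonal matrix with diagonal entries $x_1,\ldots,x_{2n}$ and all entries on the first superdiagonal and first subdiagonal equal to $1$.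
   Context: Continued fractions are $[a_1,\ldots,a_m]=a_1+\cfrac{1}{a_2+\cfrac{1}{\ddots+\cfrac{1}{a_m}}}$ with $a_i$ nonzero integers (possibly negative). The rational (2-bridge) knot $b(p,q)$ is the numerator closure of the rational tangle with fraction $p/q$; equivalently it is, up to mirror image, the $2$-bridge knot whose double branched cover is the lens space $L(p,q)$. A knot and its mirror image have the same Alexander polynomial, so the mirror convention is irrelevant. Quantum integers: $[m]_x=\frac{1-x^m}{1-x}$ for $m\in\mathbb{Z}$; thus $[2]_{-t}=1-t$ and $[2]_{-t^{-1}}=1-t^{-1}$. The Alexander polynomial is defined up to units $\pm t^j$ of $\mathbb{Z}[t,t^{-1}]$. *)

theory Defs
  imports
    "Jordan_Normal_Form.Determinant"
    "HOL-Library.Poly_Mapping"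
begin

section \<open>Laurent polynomials\<close>

text \<open>
  \<^typ>\<open>int \<Rightarrow>\<^sub>0 int\<close> with its convolution product is the group ring of the infinite cyclic group,
  i.e. the ring of Laurent polynomials in one variable with integer coefficients.
\<close>

type_synonym laurent = "int \<Rightarrow>\<^sub>0 int"

definition tpow :: "int \<Rightarrow> laurent" where
  "tpow j = Poly_Mapping.single j 1"

lemma tpow_0: "tpow 0 = 1"
  by (simp add: tpow_def)

lemma tpow_add: "tpow (i + j) = tpow i * tpow j"
  by (simp add: tpow_def mult_single)

definition unit_equiv :: "laurent \<Rightarrow> laurent \<Rightarrow> bool" (infix "\<doteq>" 50) where
  "f \<doteq> g \<longleftrightarrow> (\<exists>j. f = tpow j * g \<or> f = - (tpow j * g))"

section \<open>Continued fractions, quantum integers, continuants\<close>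

text \<open>
  Division by zero cannot occur for the continued fractions considered below: when all entries are
  nonzero even integers, every tail has absolute value greater than 1.
\<close>

fun cfrac :: "int list \<Rightarrow> rat" where
  "cfrac [] = 0"
| "cfrac [a] = of_int a"
| "cfrac (a # b # as) = of_int a + 1 / cfrac (b # as)"

text \<open>The quotient $(1 - x^m)/(1 - x)$, in a ring where \<open>1 - x\<close> need not be invertible.\<close>

definition qint :: "nat \<Rightarrow> 'a::comm_ring_1 \<Rightarrow> 'a" where
  "qint m x = (\<Sum>i<m. x ^ i)"

lemma qint_quotient: "(1 - x) * qint m x = 1 - x ^ m"
  by (simp add: qint_def one_diff_power_eq)

lemma qint_2: "qint 2 x = 1 + x"
  by (simp add: qint_def numeral_2_eq_2)

definition continuant :: "'a::comm_ring_1 list \<Rightarrow> 'a" where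
  "continuant xs = det (mat (length xs) (length xs)
     (\<lambda>(i, j). if i = j then xs ! i else if i = Suc j \<or> j = Suc i then 1 else 0))"

section \<open>Oriented diagrams and the Alexander polynomial\<close>

text \<open>
  An oriented diagram is recorded through its arcs (maximal pieces running from one undercrossing
  to the next).  \<open>Crossing a l r\<close> is a crossing with over-arc \<open>a\<close>, at which the under-arc to the
  left (right) of the oriented over-arc is \<open>l\<close> (\<open>r\<close>).  This is the information contained in the
  Wirtinger presentation: the relator of the crossing is $a\,l\,a^{-1} r^{-1}$, whatever the
  orientation of the under-strand.  Its Fox derivatives, with all generators mapped to $t$, are
  $1 - t$ at \<open>a\<close>, $t$ at \<open>l\<close> and $-1$ at \<open>r\<close>; contributions add up if arcs coincide.
\<close>

datatype crossing = Crossing (over: nat) (left: nat) (right: nat)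

type_synonym diagram = "crossing list"

definition arcs :: "diagram \<Rightarrow> nat list" where
  "arcs D = sorted_list_of_set (over ` set D \<union> left ` set D \<union> right ` set D)"

definition alexander_entry :: "crossing \<Rightarrow> nat \<Rightarrow> laurent" where
  "alexander_entry c x =
     (if over c = x then 1 - tpow 1 else 0) + (if left c = x then tpow 1 else 0)
     + (if right c = x then - 1 else 0)"

definition alexander_matrix :: "diagram \<Rightarrow> laurent mat" where
  "alexander_matrix D =
     mat (length D) (length (arcs D)) (\<lambda>(i, j). alexander_entry (D ! i) (arcs D ! j))"

text \<open>
  The Alexander polynomial is the determinant of the Alexander matrix with one row and one column
  deleted, up to units.  As a relation, this makes no choice of the row and the column.
\<close>

definition is_alexander_polynomial :: "diagram \<Rightarrow> laurent \<Rightarrow> bool" where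
  "is_alexander_polynomial D \<Delta> \<longleftrightarrow>
     (\<exists>i < dim_row (alexander_matrix D). \<exists>j < dim_col (alexander_matrix D).
        \<Delta> \<doteq> det (mat_delete (alexander_matrix D) i j))"

section \<open>Rational tangles\<close>

text \<open>
  An oriented tangle diagram has four ends.  An end is given by the arc \<open>fst e\<close> that reaches it and
  by its direction: \<open>snd e\<close> holds iff the oriented strand leaves the tangle at that end.
  The arcs of a tangle with \<open>c\<close> crossings are \<open>0, \<dots>, c + 1\<close>.
\<close>

record tangle =
  crossings :: "crossing list"
  nw :: "nat \<times> bool"
  ne :: "nat \<times> bool"
  sw :: "nat \<times> bool"
  se :: "nat \<times> bool"

text \<open>
  \<open>zero_tangle\<close> consists of two horizontal strands, \<open>infinity_tangle\<close> of two vertical ones; the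
  parameters are arbitrary orientations of the two strands.
\<close>

definition zero_tangle :: "bool \<Rightarrow> bool \<Rightarrow> tangle" where
  "zero_tangle a b =
     \<lparr>crossings = [], nw = (0, \<not> a), ne = (0, a), sw = (1, \<not> b), se = (1, b)\<rparr>"

definition infinity_tangle :: "bool \<Rightarrow> bool \<Rightarrow> tangle" where
  "infinity_tangle a b =
     \<lparr>crossings = [], nw = (0, \<not> a), ne = (1, \<not> b), sw = (0, a), se = (1, b)\<rparr>"

definition fresh_arc :: "tangle \<Rightarrow> nat" where
  "fresh_arc T = length (crossings T) + 2"

text \<open>
  The over-strand extends the end \<open>e\<close>.  Facing along the over-strand out of the tangle, the
  under-arc on the left is \<open>l\<close> and the one on the right is \<open>r\<close>.
\<close>

definition crossing_under :: "nat \<times> bool \<Rightarrow> nat \<Rightarrow> nat \<Rightarrow> crossing" where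
  "crossing_under e l r = (if snd e then Crossing (fst e) l r else Crossing (fst e) r l)"

text \<open>
  \<open>right_twist\<close> adds one crossing to the right of \<open>T\<close> (the sum with the tangle $[\pm 1]$), between
  the ends NE and SE; \<open>bottom_twist\<close> adds one crossing below \<open>T\<close> (the product with $[\pm 1]$),
  between SW and SE.  In both, the over-strand of the new crossing has positive slope (it joins the
  SW and NE corners of the crossing) if \<open>s\<close> holds, and negative slope otherwise.
\<close>

definition right_twist :: "bool \<Rightarrow> tangle \<Rightarrow> tangle" where
  "right_twist s T =
     (let z = fresh_arc T in
      if s then T\<lparr>crossings := crossing_under (se T) (fst (ne T)) z # crossings T,
                  ne := se T, se := (z, snd (ne T))\<rparr>
      else T\<lparr>crossings := crossing_under (ne T) z (fst (se T)) # crossings T,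
             se := ne T, ne := (z, snd (se T))\<rparr>)"

definition bottom_twist :: "bool \<Rightarrow> tangle \<Rightarrow> tangle" where
  "bottom_twist s T =
     (let z = fresh_arc T in
      if s then T\<lparr>crossings := crossing_under (se T) z (fst (sw T)) # crossings T,
                  sw := se T, se := (z, snd (sw T))\<rparr>
      else T\<lparr>crossings := crossing_under (sw T) (fst (se T)) z # crossings T,
             se := sw T, sw := (z, snd (se T))\<rparr>)"

text \<open>
  \<open>rational_tangle T a b\<close>: \<open>T\<close> is an oriented diagram of a rational tangle with fraction \<open>a / b\<close>
  (infinite if \<open>b = 0\<close>).  The rules are $F(T + [\pm 1]) = F(T) \pm 1$ and
  $1 / F(T * [\pm 1]) = 1 / F(T) \pm 1$.
\<close>

inductive rational_tangle :: "tangle \<Rightarrow> int \<Rightarrow> int \<Rightarrow> bool" where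
  "rational_tangle (zero_tangle x y) 0 1"
| "rational_tangle (infinity_tangle x y) 1 0"
| "rational_tangle T a b \<Longrightarrow>
     rational_tangle (right_twist s T) (if s then a + b else a - b) b"
| "rational_tangle T a b \<Longrightarrow>
     rational_tangle (bottom_twist s T) a (if s then b + a else b - a)"

text \<open>
  The numerator closure joins NW to NE and SW to SE.  It is an oriented diagram only if the
  orientations match at these ends.
\<close>

definition closable :: "tangle \<Rightarrow> bool" where
  "closable T \<longleftrightarrow> snd (nw T) \<noteq> snd (ne T) \<and> snd (sw T) \<noteq> snd (se T)"

definition merge_arcs :: "nat \<Rightarrow> nat \<Rightarrow> nat \<Rightarrow> nat" where
  "merge_arcs x y z = (if z = y then x else z)"

definition relabel :: "(nat \<Rightarrow> nat) \<Rightarrow> crossing \<Rightarrow> crossing" where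
  "relabel f c = Crossing (f (over c)) (f (left c)) (f (right c))"

definition numerator_closure :: "tangle \<Rightarrow> diagram" where
  "numerator_closure T =
     (let f = merge_arcs (fst (nw T)) (fst (ne T));
          g = merge_arcs (f (fst (sw T))) (f (fst (se T)))
      in map (relabel (g \<circ> f)) (crossings T))"

text \<open>
  \<open>rational_knot_diagram p q D\<close>: \<open>D\<close> is an oriented diagram of the rational link \<open>b(p, q)\<close>, i.e.
  the numerator closure, with any orientation, of any rational tangle diagram with fraction
  \<open>p / q\<close>.
\<close>

definition rational_knot_diagram :: "int \<Rightarrow> int \<Rightarrow> diagram \<Rightarrow> bool" where
  "rational_knot_diagram p q D \<longleftrightarrow>
     (\<exists>T a b. rational_tangle T a b \<and> b \<noteq> 0 \<and> (of_int a / of_int b :: rat) = of_int p / of_int q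
        \<and> closable T \<and> D = numerator_closure T)"

end

theory Submission
  imports Defs
begin

text \<open>
  Label the arcs of the tangle by Laurent polynomials satisfying the Alexander relations, with labels
  0 and 1 on two base arcs.  A twist determines the label of its new arc with a unit coefficient, so the
  Alexander matrix of the tangle is triangular up to units, and closing the tangle leaves the label
  difference of NW and NE as Alexander polynomial.

  The labels at the ends only depend on the fraction, up to units: exchanging a single twist with a
  double twist turns any word in the twists into a word of double twists, which is the
  even continued fraction.  For this the labels satisfy, up to units, the recursion of the continuant,
  and an even continued fraction with nonzero entries is unique.
\<close>

subsection \<open>Laurent polynomials up to units\<close>

text \<open>A diagram of \<open>b(p, q)\<close> may close any word in twists with any consistent
  orientation, so independence of the word is proved on the labels themselves. At t = -1 the labels
  at NE and SW are the numerator and the denominator of the fraction; for general t the fraction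
  fixes them only up to a unit. As \<open>q\<close> is even and \<open>p\<close> odd, the tangle
  lies in the orbit of \<open>1 / 0\<close>, and a closable orientation makes the strands
  antiparallel in both twist regions. There a double twist, which changes the fraction by an entry
  2, adds \<open>1 - t\<close> or \<open>1 - t^{-1}\<close> times one label to the other, up to
  sign: this is the origin of the quantum integers. On the side of determinants, the obstacles are
  the arbitrary deleted row and column and the arcs identified by the closure; bordering the matrix
  of the tangle by the two closing relations deals with both.\<close>

definition tunit :: "laurent \<Rightarrow> bool" where
  "tunit u \<longleftrightarrow> (\<exists>j. u = tpow j \<or> u = - tpow j)"

lemma tunit_tpow: "tunit (tpow j)"
  by (auto simp: tunit_def)

lemma tunit_1: "tunit 1"
  using tunit_tpow[of 0] by (simp add: tpow_0)

lemma tunit_minus: "tunit u \<Longrightarrow> tunit (- u)"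
  by (auto simp: tunit_def)

lemma tunit_minus_1_power: "tunit ((- 1) ^ n)"
  by (cases "even n") (auto intro: tunit_1 tunit_minus)

lemma tunit_mult: "tunit u \<Longrightarrow> tunit v \<Longrightarrow> tunit (u * v)"
  by (auto simp: tunit_def tpow_add[symmetric])

lemma tpow_inverse: "tpow j * tpow (- j) = 1"
  by (simp add: tpow_add[symmetric] tpow_0)

lemma tunit_inverse:
  assumes "tunit u"
  obtains v where "tunit v" "u * v = 1"
proof -
  from assms obtain j where "u = tpow j \<or> u = - tpow j" by (auto simp: tunit_def)
  then have "u * tpow (- j) = 1 \<or> u * (- tpow (- j)) = 1" by (auto simp: tpow_inverse)
  then show ?thesis using that[OF tunit_tpow] that[OF tunit_minus[OF tunit_tpow]] by metis
qed

lemma unit_equiv_iff: "f \<doteq> g \<longleftrightarrow> (\<exists>u. tunit u \<and> f = u * g)"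
proof
  assume "f \<doteq> g"
  then obtain j where "f = tpow j * g \<or> f = (- tpow j) * g"
    by (auto simp: unit_equiv_def)
  moreover have "tunit (tpow j)" "tunit (- tpow j)" by (auto simp: tunit_def)
  ultimately show "\<exists>u. tunit u \<and> f = u * g" by (elim disjE) (rule exI, erule (1) conjI)+
qed (auto simp: unit_equiv_def tunit_def)

lemma unit_equivI: "tunit u \<Longrightarrow> f = u * g \<Longrightarrow> f \<doteq> g"
  by (auto simp: unit_equiv_iff)

lemma unit_equiv_trans:
  assumes "f \<doteq> g" and "g \<doteq> h"
  shows "f \<doteq> h"
proof -
  obtain u v where "tunit u" "f = u * g" "tunit v" "g = v * h"
    using assms by (auto simp: unit_equiv_iff)
  then show ?thesis by (intro unit_equivI[of "u * v"]) (simp_all add: tunit_mult mult.assoc)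
qed

lemma unit_equiv_sym:
  assumes "f \<doteq> g"
  shows "g \<doteq> f"
proof -
  obtain u where u: "tunit u" "f = u * g" using assms by (auto simp: unit_equiv_iff)
  obtain v where v: "tunit v" "u * v = 1" using u(1) by (rule tunit_inverse)
  have "v * f = (u * v) * g" unfolding u(2) by (simp only: mult.assoc mult.left_commute)
  then show ?thesis using v by (intro unit_equivI[of v]) simp_all
qed

subsection \<open>Twists acting on end labels\<close>

text \<open>Neither twist involves the end NW: its arc remains arc 0 with label 0, so no label of NW
  is stored.\<close>

datatype state = State (nw_out: bool) (ne_out: bool) (sw_out: bool) (se_out: bool)
  (ne_label: laurent) (sw_label: laurent) (se_label: laurent)

definition tau :: "bool \<Rightarrow> laurent" where
  "tau b = tpow (if b then 1 else - 1)"

lemma tunit_tau: "tunit (tau b)"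
  by (simp add: tau_def tunit_tpow)

lemma tau_inverse: "tau b * tau (\<not> b) = 1"
  by (cases b) (simp_all add: tau_def tpow_inverse mult.commute)

text \<open>The new label solves the crossing relation \<open>(1 - t) a + t l - r = 0\<close> for
  the new under-arc: the old under-arc gets the coefficient t if the new arc lies to the right of
  the oriented over-strand, and the inverse of t otherwise.\<close>

fun rtwist :: "bool \<Rightarrow> state \<Rightarrow> state" where
  "rtwist True (State n e w f x y z) = State n f w e z y ((1 - tau f) * z + tau f * x)"
| "rtwist False (State n e w f x y z) = State n f w e ((1 - tau (\<not> e)) * x + tau (\<not> e) * z) y x"

fun btwist :: "bool \<Rightarrow> state \<Rightarrow> state" where
  "btwist True (State n e w f x y z) = State n e f w x z ((1 - tau (\<not> f)) * z + tau (\<not> f) * y)"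
| "btwist False (State n e w f x y z) = State n e f w x ((1 - tau w) * y + tau w * z) y"

fun scale :: "laurent \<Rightarrow> state \<Rightarrow> state" where
  "scale u (State n e w f x y z) = State n e w f (u * x) (u * y) (u * z)"

text \<open>The product of the meridians at the four ends, in their cyclic order, is trivial.  The labels
  at the ends satisfy the Fox derivative of this relation; with the label at NW normalized to 0 it expresses the label at SE by the
  labels at NE and SW, in a way that depends on the orientations.\<close>

fun planar :: "state \<Rightarrow> bool" where
  "planar (State n e w f x y z) \<longleftrightarrow>
     (n = e \<and> w = f \<and> n \<noteq> w \<and> z = x - tau n * y) \<or>
     (n = w \<and> e = f \<and> n \<noteq> e \<and> z = y - tau (\<not> n) * x) \<or>
     (n = f \<and> e = w \<and> n \<noteq> e \<and> z = x + y)"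

lemma tau_cancel: "tau True * tau False = 1" "tau True * (tau False * x) = x"
  "tau False * tau True = 1" "tau False * (tau True * x) = x"
  using tau_inverse[of True] tau_inverse[of False] by (simp_all flip: mult.assoc)

lemma scale_scale: "scale u (scale v s) = scale (u * v) s"
  by (cases s) (simp add: mult.assoc)

lemma rtwist_scale: "rtwist b (scale u s) = scale u (rtwist b s)"
  by (cases s; cases b) (simp_all add: algebra_simps)

lemma btwist_scale: "btwist b (scale u s) = scale u (btwist b s)"
  by (cases s; cases b) (simp_all add: algebra_simps)

text \<open>The second Reidemeister move on labels: the Alexander quandle operations for t and its
  inverse undo each other.\<close>

lemma inverse_combination:
  fixes x y t s :: "'a :: comm_ring_1"
  assumes "t * s = 1"
  shows "(1 - t) * x + t * ((1 - s) * x + s * y) = y"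
proof -
  have "(1 - t) * x + t * ((1 - s) * x + s * y) = x + t * s * (y - x)"
    by (simp add: algebra_simps)
  then show ?thesis using assms by simp
qed

lemma rtwist_rtwist: "rtwist (\<not> b) (rtwist b s) = s"
  by (cases s; cases b) (simp_all add: inverse_combination[OF tau_inverse]
        inverse_combination[OF tau_inverse[of "\<not> b" for b, simplified]])

lemma btwist_btwist: "btwist (\<not> b) (btwist b s) = s"
  by (cases s; cases b) (simp_all add: inverse_combination[OF tau_inverse]
        inverse_combination[OF tau_inverse[of "\<not> b" for b, simplified]])

text \<open>Two ends are outgoing and two incoming, so exactly one other end has the direction of
  NW. In each of the three patterns only the labels at NE and SW are free.\<close>

lemma planar_cases:
  assumes "planar s"
  obtains n x y where "s = State n n (\<not> n) (\<not> n) x y (x - tau n * y)"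
  | n x y where "s = State n (\<not> n) n (\<not> n) x y (y - tau (\<not> n) * x)"
  | n x y where "s = State n (\<not> n) (\<not> n) n x y (x + y)"
proof (cases s)
  case (State n e w f x y z)
  then have "(n = e \<and> w = (\<not> n) \<and> f = (\<not> n) \<and> z = x - tau n * y) \<or>
     (w = n \<and> e = (\<not> n) \<and> f = (\<not> n) \<and> z = y - tau (\<not> n) * x) \<or>
     (f = n \<and> e = (\<not> n) \<and> w = (\<not> n) \<and> z = x + y)"
    using assms by auto
  then show ?thesis
    using State that(1)[of n x y] that(2)[of n x y] that(3)[of n x y] by auto
qed

lemma planar_scale: "planar s \<Longrightarrow> planar (scale u s)"
  by (erule planar_cases) (simp_all add: algebra_simps)

lemma planar_twist:
  assumes "planar s"
  shows "planar (rtwist b s)" and "planar (btwist b s)"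
  using assms
  by (rule planar_cases; rename_tac n x y; case_tac n; cases b; simp add: algebra_simps tau_cancel)+

text \<open>The matrices \<open>R\<close> and \<open>B\<close> of the two twists satisfy $R B^2 R^{-1} = - R^2 B^{-2}$ in
  $SL_2(\mathbb{Z})$; on labels the sign becomes a unit.\<close>

lemma twist_exchange:
  assumes "planar s"
  shows "rtwist False (btwist True (btwist True s)) =
      scale (tau (nw_out s)) (btwist False (btwist False (rtwist True s)))"
    and "rtwist True (btwist False (btwist False s)) =
      scale (tau (\<not> nw_out s)) (btwist True (btwist True (rtwist False s)))"
    and "btwist False (rtwist True (rtwist True s)) =
      scale (tau (\<not> nw_out s)) (rtwist False (rtwist False (btwist True s)))"
    and "btwist True (rtwist False (rtwist False s)) =
      scale (tau (nw_out s)) (rtwist True (rtwist True (btwist False s)))"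
  using assms
  by (rule planar_cases; rename_tac n x y; case_tac n; simp add: algebra_simps tau_cancel)+

subsection \<open>Even continued fractions\<close>

text \<open>Double twists generate (projectively) the congruence subgroup of level 2, whose orbits on the
  fractions are those of \<open>0\<close>, \<open>1 / 0\<close> and \<open>- 1\<close>.\<close>

inductive reachable :: "state \<Rightarrow> int \<Rightarrow> int \<Rightarrow> bool" where
  zero: "reachable (State (\<not> c) c (\<not> d) d 0 1 1) 0 1"
| infinity: "reachable (State (\<not> c) (\<not> d) c d 1 0 1) 1 0"
| one: "reachable (rtwist False (State (\<not> c) c (\<not> d) d 0 1 1)) (- 1) 1"
| rtwist2: "reachable s a b \<Longrightarrow> reachable (rtwist p (rtwist p s)) (if p then a + 2 * b else a - 2 * b) b"
| btwist2: "reachable s a b \<Longrightarrow> reachable (btwist p (btwist p s)) a (if p then b + 2 * a else b - 2 * a)"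
| scale: "reachable s a b \<Longrightarrow> tunit u \<Longrightarrow> reachable (scale u s) a b"
| neg: "reachable s a b \<Longrightarrow> reachable s (- a) (- b)"

lemma reachable_planar: "reachable s a b \<Longrightarrow> planar s"
  by (induction rule: reachable.induct) (auto intro!: planar_twist planar_scale simp: tau_inverse tau_cancel)

text \<open>A single twist is pushed through the double twists: right ones commute with it, bottom
  ones are exchanged at the cost of a unit and of the signs of numerator and denominator, whence the
  clauses \<open>scale\<close> and \<open>neg\<close>. On the base states it maps 0 to -1, -1 to a
  double twist of 0, and fixes infinity.\<close>

lemma reachable_rtwist_False: "reachable s a b \<Longrightarrow> reachable (rtwist False s) (a - b) b"
proof (induction rule: reachable.induct)
  case (zero c d)
  then show ?case using reachable.one by simp
next
  case (infinity c d)
  then show ?case using reachable.infinity[of c "\<not> d"] by simp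
next
  case (one c d)
  then show ?case using rtwist2[OF zero, of False c d] by simp
next
  case (rtwist2 s a b p)
  have "rtwist False (rtwist p (rtwist p s)) = rtwist p (rtwist p (rtwist False s))"
    using rtwist_rtwist[of True] rtwist_rtwist[of False] by (cases p) simp_all
  then show ?case using reachable.rtwist2[OF rtwist2.IH, of p] by (simp add: algebra_simps split: if_splits)
next
  case (btwist2 s a b p)
  note ex = twist_exchange[OF reachable_planar[OF btwist2.hyps]]
  show ?case
  proof (cases p)
    case True
    \<comment> \<open>The exchange produces the positive twist of \<open>s\<close>, while the
      induction hypothesis concerns the negative one; they differ by a double twist.\<close>
    have "rtwist True s = rtwist True (rtwist True (rtwist False s))"
      using rtwist_rtwist[of False s] by simp
    then show ?thesis
      using reachable.scale[OF reachable.neg[OF reachable.btwist2[OF reachable.rtwist2[OF btwist2.IH, of True], of False]]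
          tunit_tau[of "nw_out s"]] True ex(1) by (simp add: algebra_simps)
  next
    case False
    have "rtwist False (btwist False (btwist False s)) =
        rtwist False (rtwist False (rtwist True (btwist False (btwist False s))))"
      using rtwist_rtwist[of True] by simp
    then show ?thesis
      using reachable.neg[OF reachable.rtwist2[OF reachable.scale[OF reachable.btwist2[OF btwist2.IH, of True]
          tunit_tau[of "\<not> nw_out s"]], of False]] False ex(2) by (simp add: algebra_simps)
  qed
next
  case (scale s a b u)
  then show ?case using reachable.scale by (simp add: rtwist_scale)
next
  case (neg s a b)
  then show ?case using reachable.neg[OF neg.IH] by simp
qed

lemma reachable_btwist_False: "reachable s a b \<Longrightarrow> reachable (btwist False s) a (b - a)"
proof (induction rule: reachable.induct)
  case (zero c d)
  then show ?case using reachable.zero[of c "\<not> d"] by simp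
next
  case (infinity c d)
  \<comment> \<open>The tangle with one crossing arises from the zero tangle by a right twist and
    from the infinity tangle by a bottom twist. The base arcs differ, so the normalized labels
    differ by a unit.\<close>
  have "tau c * tau (\<not> c) = 1" by (rule tau_inverse)
  then have "scale (tau c) (rtwist False (State (\<not> c) c d (\<not> d) 0 1 1)) =
      btwist False (State (\<not> c) (\<not> d) c d 1 0 1)" by simp
  then show ?case
    using reachable.neg[OF reachable.scale[OF reachable.one[of c "\<not> d"] tunit_tau[of c]]] by simp
next
  case (one c d)
  have "tau c * tau (\<not> c) = 1" by (rule tau_inverse)
  then have "rtwist False (State (\<not> c) c (\<not> d) d 0 1 1) =
      scale (tau (\<not> c)) (btwist False (State (\<not> c) d c (\<not> d) 1 0 1))"
    by (simp add: mult.commute)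
  then show ?case
    using reachable.scale[OF reachable.neg[OF reachable.btwist2[OF reachable.infinity[of c "\<not> d"], of False]]
      tunit_tau[of "\<not> c"]] by (simp only: btwist_scale) simp
next
  case (rtwist2 s a b p)
  note ex = twist_exchange[OF reachable_planar[OF rtwist2.hyps]]
  show ?case
  proof (cases p)
    case True
    have "btwist True s = btwist True (btwist True (btwist False s))"
      using btwist_btwist[of False s] by simp
    then show ?thesis
      using reachable.scale[OF reachable.neg[OF reachable.rtwist2[OF reachable.btwist2[OF rtwist2.IH, of True], of False]]
          tunit_tau[of "\<not> nw_out s"]] True ex(3) by (simp add: algebra_simps)
  next
    case False
    have "btwist False (rtwist False (rtwist False s)) =
        btwist False (btwist False (btwist True (rtwist False (rtwist False s))))"
      using btwist_btwist[of True] by simp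
    then show ?thesis
      using reachable.neg[OF reachable.btwist2[OF reachable.scale[OF reachable.rtwist2[OF rtwist2.IH, of True]
          tunit_tau[of "nw_out s"]], of False]] False ex(4) by (simp add: algebra_simps)
  qed
next
  case (btwist2 s a b p)
  have "btwist False (btwist p (btwist p s)) = btwist p (btwist p (btwist False s))"
    using btwist_btwist[of True] btwist_btwist[of False] by (cases p) simp_all
  then show ?case using reachable.btwist2[OF btwist2.IH, of p] by (simp add: algebra_simps split: if_splits)
next
  case (scale s a b u)
  then show ?case using reachable.scale by (simp add: btwist_scale)
next
  case (neg s a b)
  then show ?case using reachable.neg[OF neg.IH] by simp
qed

lemma reachable_rtwist:
  assumes "reachable s a b"
  shows "reachable (rtwist p s) (if p then a + b else a - b) b"
proof (cases p)
  case True
  then show ?thesis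
    using reachable.rtwist2[OF reachable_rtwist_False[OF assms], of True] rtwist_rtwist[of False s]
    by (simp add: algebra_simps)
qed (use reachable_rtwist_False[OF assms] in simp)

lemma reachable_btwist:
  assumes "reachable s a b"
  shows "reachable (btwist p s) a (if p then b + a else b - a)"
proof (cases p)
  case True
  then show ?thesis
    using reachable.btwist2[OF reachable_btwist_False[OF assms], of True] btwist_btwist[of False s]
    by (simp add: algebra_simps)
qed (use reachable_btwist_False[OF assms] in simp)

text \<open>A pair \<open>(k, l)\<close> stands for the two consecutive entries \<open>2k, 2l\<close> of a continued fraction; the
  value is a numerator and a denominator.\<close>

fun even_cfrac :: "(int \<times> int) list \<Rightarrow> int \<times> int" where
  "even_cfrac [] = (1, 0)"
| "even_cfrac ((k, l) # ks) =
     (let (a, b) = even_cfrac ks; b' = b + 2 * l * a in (a + 2 * k * b', b'))"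

text \<open>The t-analogue of \<open>even_cfrac\<close>: the entries 2k and 2l become k and l times
  \<open>1 - t\<close> or \<open>1 - t^{-1}\<close>, depending on the orientation \<open>c\<close>;
  t = -1 gives back \<open>even_cfrac\<close>.\<close>

fun label_cfrac :: "bool \<Rightarrow> (int \<times> int) list \<Rightarrow> laurent \<times> laurent" where
  "label_cfrac c [] = (1, 0)"
| "label_cfrac c ((k, l) # ks) =
     (let (x, y) = label_cfrac c ks; y' = y + of_int l * (1 - tau c) * x
      in (x + of_int k * (1 - tau (\<not> c)) * y', y'))"

definition nonzero_pairs :: "(int \<times> int) list \<Rightarrow> bool" where
  "nonzero_pairs ks \<longleftrightarrow> (\<forall>(k, l) \<in> set ks. k \<noteq> 0 \<and> l \<noteq> 0)"

text \<open>The leading k may vanish, since right double twists change it by one at a time and can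
  pass through 0.\<close>

fun reduced :: "(int \<times> int) list \<Rightarrow> bool" where
  "reduced [] \<longleftrightarrow> True"
| "reduced ((k, l) # ks) \<longleftrightarrow> l \<noteq> 0 \<and> nonzero_pairs ks"

lemma nonzero_pairs_reduced: "nonzero_pairs ks \<Longrightarrow> reduced ks"
  by (cases ks rule: reduced.cases) (auto simp: nonzero_pairs_def)

fun closed_state :: "bool \<Rightarrow> laurent \<times> laurent \<Rightarrow> state" where
  "closed_state c (x, y) = State (\<not> c) c c (\<not> c) x y (x + y)"

text \<open>The ends NE and SE have opposite directions, so the two crossings of the double twist
  contribute different powers of t, and their combined effect is a multiple of
  \<open>1 - tau (\<not> c)\<close>.\<close>

lemma rtwist2_closed_state:
  "rtwist p (rtwist p (closed_state c (x, y))) =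
     closed_state c (x + (if p then 1 else - 1) * (1 - tau (\<not> c)) * y, y)"
  by (cases p; cases c; simp add: algebra_simps tau_cancel)

lemma btwist2_closed_state:
  "btwist p (btwist p (closed_state c (x, y))) =
     closed_state c (x, y + (if p then 1 else - 1) * (1 - tau c) * x)"
  by (cases p; cases c; simp add: algebra_simps tau_cancel)

lemma rtwist2_closed_state_label_cfrac:
  assumes "reduced ks"
  obtains ks' where "reduced ks'"
    and "closed_state c (label_cfrac c ks') = rtwist p (rtwist p (closed_state c (label_cfrac c ks)))"
    and "even_cfrac ks' = (fst (even_cfrac ks) + (if p then 2 else - 2) * snd (even_cfrac ks), snd (even_cfrac ks))"
proof (cases ks rule: reduced.cases)
  case 1
  then show ?thesis using that[of ks] assms by (cases p; cases c) simp_all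
next
  case (2 k l r)
  define e :: int where "e = (if p then 1 else - 1)"
  obtain x y where xy: "label_cfrac c r = (x, y)" by fastforce
  obtain a b where ab: "even_cfrac r = (a, b)" by fastforce
  show ?thesis
  proof (rule that)
    show "reduced ((k + e, l) # r)" using assms 2 by simp
    show "closed_state c (label_cfrac c ((k + e, l) # r)) =
        rtwist p (rtwist p (closed_state c (label_cfrac c ks)))"
      unfolding 2 label_cfrac.simps xy
      by (simp only: Let_def prod.case rtwist2_closed_state) (simp add: e_def algebra_simps)
    show "even_cfrac ((k + e, l) # r) =
        (fst (even_cfrac ks) + (if p then 2 else - 2) * snd (even_cfrac ks), snd (even_cfrac ks))"
      unfolding 2 by (simp add: ab e_def algebra_simps)
  qed
qed

text \<open>If the leading k is nonzero or the list is empty, the double twist opens a new pair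
  \<open>(0, e)\<close>. If k = 0, it is absorbed into the leading l; should l become 0, the whole
  pair disappears and its tail is again reduced.\<close>

lemma btwist2_closed_state_label_cfrac:
  assumes "reduced ks"
  obtains ks' where "reduced ks'"
    and "closed_state c (label_cfrac c ks') = btwist p (btwist p (closed_state c (label_cfrac c ks)))"
    and "even_cfrac ks' = (fst (even_cfrac ks), snd (even_cfrac ks) + (if p then 2 else - 2) * fst (even_cfrac ks))"
proof -
  define e :: int where "e = (if p then 1 else - 1)"
  obtain x y where xy: "label_cfrac c ks = (x, y)" by fastforce
  obtain a b where ab: "even_cfrac ks = (a, b)" by fastforce
  have st: "btwist p (btwist p (closed_state c (label_cfrac c ks))) =
      closed_state c (x, y + of_int e * (1 - tau c) * x)"
    unfolding xy btwist2_closed_state by (simp add: e_def)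
  have ev: "(fst (even_cfrac ks), snd (even_cfrac ks) + (if p then 2 else - 2) * fst (even_cfrac ks)) =
      (a, b + 2 * e * a)"
    unfolding ab by (simp add: e_def)
  show ?thesis
  proof (cases "ks = [] \<or> fst (hd ks) \<noteq> 0")
    case True
    show ?thesis
    proof (rule that)
      show "reduced ((0, e) # ks)" using True assms
        by (cases ks rule: reduced.cases) (auto simp: e_def nonzero_pairs_def)
    qed (unfold st ev, simp_all add: xy ab algebra_simps)
  next
    case False
    then obtain l r where ks: "ks = (0, l) # r" by (cases ks rule: reduced.cases) auto
    obtain x' y' where xy': "label_cfrac c r = (x', y')" by fastforce
    obtain a' b' where ab': "even_cfrac r = (a', b')" by fastforce
    have eqs: "x = x'" "y = y' + of_int l * (1 - tau c) * x'" "a = a'" "b = b' + 2 * l * a'"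
      using xy ab unfolding ks by (auto simp: xy' ab')
    show ?thesis
    proof (cases "l + e = 0")
      case True
      then have e: "e = - l" by simp
      show ?thesis
      proof (rule that)
        show "reduced r" using assms ks by (simp add: nonzero_pairs_reduced)
      qed (unfold st ev eqs e, simp_all add: xy' ab' algebra_simps)
    next
      case False
      show ?thesis
      proof (rule that)
        show "reduced ((0, l + e) # r)" using assms ks False by simp
      qed (unfold st ev eqs, simp_all add: xy' ab' algebra_simps)
    qed
  qed
qed

text \<open>Double twists preserve parities and directions. The parities exclude the orbits of 0 and
  -1, the directions exclude the infinity tangle with parallel strands. Because of
  \<open>neg\<close>, fractions are compared by cross-multiplication.\<close>

lemma reachable_closed_state:
  assumes "reachable s a b" and "odd a" and "even b"
    and "nw_out s \<noteq> ne_out s" and "sw_out s \<noteq> se_out s"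
  shows "\<exists>c u ks. tunit u \<and> reduced ks \<and> s = scale u (closed_state c (label_cfrac c ks)) \<and>
    a * snd (even_cfrac ks) = b * fst (even_cfrac ks)"
  using assms
proof (induction rule: reachable.induct)
  case (zero c d)
  then show ?case by simp
next
  case (infinity c d)
  then have "d = (\<not> c)" by auto
  then have "State (\<not> c) (\<not> d) c d 1 0 1 = scale 1 (closed_state c (label_cfrac c []))" by simp
  then show ?case using tunit_1 by (intro exI[of _ c] exI[of _ 1] exI[of _ "[]"]) simp
next
  case (one c d)
  then show ?case by simp
next
  case (rtwist2 s a b p)
  have "nw_out s \<noteq> ne_out s" "sw_out s \<noteq> se_out s"
    using rtwist2.prems by (cases s; cases p; simp)+
  then obtain c u ks where IH: "tunit u" "reduced ks" "s = scale u (closed_state c (label_cfrac c ks))"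
    "a * snd (even_cfrac ks) = b * fst (even_cfrac ks)"
    using rtwist2 by (auto split: if_splits)
  obtain ks' where "reduced ks'"
    "closed_state c (label_cfrac c ks') = rtwist p (rtwist p (closed_state c (label_cfrac c ks)))"
    "even_cfrac ks' = (fst (even_cfrac ks) + (if p then 2 else - 2) * snd (even_cfrac ks), snd (even_cfrac ks))"
    using rtwist2_closed_state_label_cfrac[OF IH(2)] .
  then show ?case using IH
    by (intro exI[of _ c] exI[of _ u] exI[of _ ks']) (simp add: rtwist_scale algebra_simps)
next
  case (btwist2 s a b p)
  have "nw_out s \<noteq> ne_out s" "sw_out s \<noteq> se_out s"
    using btwist2.prems by (cases s; cases p; simp)+
  then obtain c u ks where IH: "tunit u" "reduced ks" "s = scale u (closed_state c (label_cfrac c ks))"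
    "a * snd (even_cfrac ks) = b * fst (even_cfrac ks)"
    using btwist2 by (auto split: if_splits)
  obtain ks' where "reduced ks'"
    "closed_state c (label_cfrac c ks') = btwist p (btwist p (closed_state c (label_cfrac c ks)))"
    "even_cfrac ks' = (fst (even_cfrac ks), snd (even_cfrac ks) + (if p then 2 else - 2) * fst (even_cfrac ks))"
    using btwist2_closed_state_label_cfrac[OF IH(2)] .
  then show ?case using IH
    by (intro exI[of _ c] exI[of _ u] exI[of _ ks']) (simp add: btwist_scale algebra_simps)
next
  case (scale s a b u)
  have "nw_out s \<noteq> ne_out s" "sw_out s \<noteq> se_out s"
    using scale.prems by (cases s; simp)+
  then obtain c v ks where "tunit v" "reduced ks" "s = scale v (closed_state c (label_cfrac c ks))"
    "a * snd (even_cfrac ks) = b * fst (even_cfrac ks)"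
    using scale by auto
  then show ?case using scale.hyps
    by (intro exI[of _ c] exI[of _ "u * v"] exI[of _ ks]) (simp add: tunit_mult scale_scale)
next
  case (neg s a b)
  then show ?case by simp
qed

section \<open>Uniqueness of even continued fractions\<close>

lemma even_cfrac_abs_less: "nonzero_pairs ks \<Longrightarrow> \<bar>snd (even_cfrac ks)\<bar> < \<bar>fst (even_cfrac ks)\<bar>"
  and even_cfrac_Cons_abs_less: "nonzero_pairs ks \<Longrightarrow> l \<noteq> 0 \<Longrightarrow>
    \<bar>fst (even_cfrac ks)\<bar> < \<bar>snd (even_cfrac ks) + 2 * l * fst (even_cfrac ks)\<bar>"
proof -
  \<comment> \<open>An entry of absolute value at least 2 outweighs a quotient of absolute value
    below 1, so absolute values grow strictly with every entry.\<close>
  have grow: "\<bar>x\<bar> < \<bar>y + 2 * m * x\<bar>" if "\<bar>y\<bar> < \<bar>x\<bar>" "m \<noteq> 0" for x y m :: int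
  proof -
    have "1 * \<bar>x\<bar> \<le> \<bar>m\<bar> * \<bar>x\<bar>" using that by (intro mult_right_mono) auto
    then have "2 * \<bar>x\<bar> \<le> \<bar>2 * m * x\<bar>" by (simp add: abs_mult)
    then show ?thesis using that by linarith
  qed
  show *: "\<bar>snd (even_cfrac ks)\<bar> < \<bar>fst (even_cfrac ks)\<bar>" if "nonzero_pairs ks" for ks
    using that
  proof (induction ks rule: even_cfrac.induct)
    case (2 k l ks)
    then have "\<bar>snd (even_cfrac ks)\<bar> < \<bar>fst (even_cfrac ks)\<bar>" "k \<noteq> 0" "l \<noteq> 0"
      by (auto simp: nonzero_pairs_def)
    then show ?case using grow[OF grow] by (auto simp: Let_def split: prod.split)
  qed simp
  show "nonzero_pairs ks \<Longrightarrow> l \<noteq> 0 \<Longrightarrow>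
    \<bar>fst (even_cfrac ks)\<bar> < \<bar>snd (even_cfrac ks) + 2 * l * fst (even_cfrac ks)\<bar>"
    using grow[OF *] .
qed

text \<open>The quotients x / y and z / w have absolute value below 1, so the even integers 2k and
  2m differ by less than 2.\<close>

lemma even_quotient_unique:
  fixes x y z w k m :: int
  assumes "(x + 2 * k * y) * w = (z + 2 * m * w) * y" and "\<bar>x\<bar> < \<bar>y\<bar>" and "\<bar>z\<bar> < \<bar>w\<bar>"
  shows "k = m" and "x * w = z * y"
proof -
  have eq: "2 * (m - k) * (y * w) = x * w - z * y" using assms(1) by (simp add: algebra_simps)
  have "\<bar>x * w - z * y\<bar> \<le> \<bar>x\<bar> * \<bar>w\<bar> + \<bar>z\<bar> * \<bar>y\<bar>"
    unfolding abs_mult[symmetric] by linarith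
  also have "\<dots> < \<bar>y\<bar> * \<bar>w\<bar> + \<bar>w\<bar> * \<bar>y\<bar>"
    using assms(2,3) by (intro add_strict_mono mult_strict_right_mono) auto
  finally have less: "\<bar>2 * (m - k)\<bar> * \<bar>y * w\<bar> < 2 * \<bar>y * w\<bar>"
    unfolding eq[symmetric] by (simp add: abs_mult mult.commute)
  then have "\<bar>2 * (m - k)\<bar> < 2" by (rule mult_right_less_imp_less) simp
  then show "k = m" by simp
  then show "x * w = z * y" using eq by simp
qed

lemma even_cfrac_Cons:
  "even_cfrac ((k, l) # ks) =
     (fst (even_cfrac ks) + 2 * k * (snd (even_cfrac ks) + 2 * l * fst (even_cfrac ks)),
      snd (even_cfrac ks) + 2 * l * fst (even_cfrac ks))"
  by (simp add: Let_def split: prod.split)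

text \<open>\<open>even_quotient_unique\<close> recovers k from the value and then l from the
  reciprocal of the remainder. Among reduced lists only the empty one has denominator 0.\<close>

lemma reduced_unique:
  assumes "reduced ks" and "reduced ks'"
    and "fst (even_cfrac ks) * snd (even_cfrac ks') = fst (even_cfrac ks') * snd (even_cfrac ks)"
  shows "ks = ks'"
  using assms
proof (induction ks arbitrary: ks' rule: even_cfrac.induct)
  case 1
  show ?case
  proof (cases ks' rule: reduced.cases)
    case (2 k l r)
    then show ?thesis using 1 even_cfrac_Cons_abs_less[of r l] by (simp add: even_cfrac_Cons del: even_cfrac.simps(2))
  qed simp
next
  case (2 k l r)
  show ?case
  proof (cases ks' rule: reduced.cases)
    case 1
    then show ?thesis using 2 even_cfrac_Cons_abs_less[of r l] by (simp add: even_cfrac_Cons del: even_cfrac.simps(2))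
  next
    case ks': (2 m n r')
    let ?a = "fst (even_cfrac r)" and ?b = "snd (even_cfrac r)"
    let ?a' = "fst (even_cfrac r')" and ?b' = "snd (even_cfrac r')"
    have nz: "nonzero_pairs r" "nonzero_pairs r'" "l \<noteq> 0" "n \<noteq> 0" using 2 ks' by auto
    note less = even_cfrac_abs_less[OF nz(1)] even_cfrac_abs_less[OF nz(2)]
      even_cfrac_Cons_abs_less[OF nz(1,3)] even_cfrac_Cons_abs_less[OF nz(2,4)]
    have "k = m" "?a * (?b' + 2 * n * ?a') = ?a' * (?b + 2 * l * ?a)"
      using even_quotient_unique[OF _ less(3,4), of k m] 2(4) by (simp_all add: ks' even_cfrac_Cons del: even_cfrac.simps(2))
    moreover from this have "n = l" "?b' * ?a = ?b * ?a'"
      using even_quotient_unique[OF _ less(2,1), of n l] by (simp_all add: mult.commute)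
    moreover have "r = r'"
      using 2(1)[of r'] nz nonzero_pairs_reduced calculation by (simp add: mult.commute)
    ultimately show ?thesis using ks' by simp
  qed
qed

section \<open>Continuants and even continued fractions\<close>

lemma continuant_Nil: "continuant [] = 1"
  by (simp add: continuant_def det_def)

lemma continuant_single: "continuant [x] = x"
  by (simp add: continuant_def det_def)

text \<open>Laplace expansion along the first row, then along the first column of the second minor.
  The sign is a minus because both off-diagonals are 1.\<close>

lemma continuant_Cons_Cons: "continuant (x # y # zs) = x * continuant (y # zs) - continuant zs"
proof -
  define M where "M xs = mat (length xs) (length xs)
     (\<lambda>(i, j). if i = j then xs ! i else if i = Suc j \<or> j = Suc i then 1 else 0)" for xs :: "'a list"
  let ?A = "M (x # y # zs)"
  let ?m = "Suc (length zs)"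
  let ?B = "mat_delete ?A 0 (Suc 0)"
  have cont: "continuant xs = det (M xs)" for xs by (simp add: continuant_def M_def)
  have A: "?A \<in> carrier_mat (Suc ?m) (Suc ?m)" by (simp add: M_def)
  have B: "?B \<in> carrier_mat ?m ?m" by (simp add: M_def mat_delete_def)
  have d0: "mat_delete ?A 0 0 = M (y # zs)"
    by (rule eq_matI) (simp_all add: M_def mat_delete_def)
  have d1: "mat_delete ?B 0 0 = M zs"
    by (rule eq_matI) (simp_all add: M_def mat_delete_def)
  have "det ?B = (\<Sum>i<?m. ?B $$ (i, 0) * cofactor ?B i 0)"
    by (rule laplace_expansion_column[OF B]) simp
  also have "\<dots> = ?B $$ (0, 0) * cofactor ?B 0 0 + (\<Sum>i<length zs. ?B $$ (Suc i, 0) * cofactor ?B (Suc i) 0)"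
    by (rule sum.lessThan_Suc_shift)
  also have "\<dots> = det (M zs)"
    by (simp add: cofactor_def d1) (simp add: M_def mat_delete_def)
  finally have detB: "det ?B = det (M zs)" .
  have "det ?A = (\<Sum>j<Suc ?m. ?A $$ (0, j) * cofactor ?A 0 j)"
    by (rule laplace_expansion_row[OF A]) simp
  also have "\<dots> = ?A $$ (0, 0) * cofactor ?A 0 0 + (?A $$ (0, Suc 0) * cofactor ?A 0 (Suc 0)
      + (\<Sum>j<length zs. ?A $$ (0, Suc (Suc j)) * cofactor ?A 0 (Suc (Suc j))))"
    by (simp only: sum.lessThan_Suc_shift)
  also have "\<dots> = x * det (M (y # zs)) - det (M zs)"
    using detB by (simp add: cofactor_def d0) (simp add: M_def)
  finally show ?thesis by (simp only: cont)
qed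

lemma upt_pairs: "[1..<2 * n + 1] = concat (map (\<lambda>i. [2 * i + 1, 2 * i + 2]) [0..<n])"
proof (induction n)
  case (Suc n)
  have "[1..<2 * Suc n + 1] = [1..<2 * n + 1] @ [2 * n + 1, 2 * n + 2]"
    by (simp add: numeral_2_eq_2)
  then show ?case using Suc by simp
qed simp

lemma map_upt_pairs:
  "map (\<lambda>i. if odd i then f (k i) else g (k i)) [1..<2 * n + 1] =
     concat (map (\<lambda>(k, l). [f k, g l]) (map (\<lambda>i. (k (2 * i + 1), k (2 * i + 2))) [0..<n]))"
  unfolding upt_pairs by (simp add: map_concat comp_def)

lemma cfrac_pairs:
  assumes "nonzero_pairs ks" and "ks \<noteq> []"
  shows "cfrac (concat (map (\<lambda>(k, l). [2 * k, 2 * l]) ks)) =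
    of_int (fst (even_cfrac ks)) / of_int (snd (even_cfrac ks))"
  using assms
proof (induction ks rule: even_cfrac.induct)
  case (2 k l ks)
  let ?a = "fst (even_cfrac ks)" and ?b = "snd (even_cfrac ks)"
  let ?b' = "?b + 2 * l * ?a"
  have nz: "nonzero_pairs ks" "l \<noteq> 0" using 2 by (auto simp: nonzero_pairs_def)
  have a: "?a \<noteq> 0" using even_cfrac_abs_less[OF nz(1)] by auto
  have b': "?b' \<noteq> 0" using even_cfrac_Cons_abs_less[OF nz] by auto
  define r where "r = concat (map (\<lambda>(k, l). [2 * k, 2 * l]) ks)"
  \<comment> \<open>\<open>cfrac\<close> takes no reciprocal after its last entry, hence the split;
    the value \<open>(1, 0)\<close> of the empty list makes the formula hold there too.\<close>
  have *: "cfrac (2 * l # r) = of_int ?b' / of_int ?a"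
  proof (cases ks rule: even_cfrac.cases)
    case 1
    then show ?thesis by (simp add: r_def)
  next
    case (2 k' l' ks')
    have "?b \<noteq> 0"
      using even_cfrac_Cons_abs_less[of ks' l'] nz(1) unfolding 2
      by (auto simp: even_cfrac_Cons nonzero_pairs_def simp del: even_cfrac.simps(2))
    have "cfrac (2 * l # r) = of_int (2 * l) + 1 / cfrac r"
      unfolding r_def 2 by simp
    also have "cfrac r = of_int ?a / of_int ?b"
      unfolding r_def using "2.IH" nz 2 by simp
    finally show ?thesis using a \<open>?b \<noteq> 0\<close> by (simp add: field_simps)
  qed
  have "cfrac (concat (map (\<lambda>(k, l). [2 * k, 2 * l]) ((k, l) # ks))) = of_int (2 * k) + 1 / cfrac (2 * l # r)"
    by (simp add: r_def)
  also have "\<dots> = (of_int ?a + 2 * of_int k * of_int ?b') / of_int ?b'"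
    using b' unfolding * by (simp add: field_simps del: of_int_add of_int_mult)
  finally show ?case by (simp add: even_cfrac_Cons del: even_cfrac.simps(2))
qed simp

text \<open>The minus signs at even positions turn the subtractive recursion of continuants into the
  additive one of \<open>label_cfrac\<close>, at the price of one sign per pair.\<close>

lemma continuant_label_cfrac:
  defines "L \<equiv> \<lambda>ks. concat (map (\<lambda>(k, l).
    [qint 2 (- tpow 1) * of_int k, - qint 2 (- tpow (- 1)) * of_int l]) ks)"
  shows "continuant (L ks) = (- 1) ^ length ks * fst (label_cfrac False ks)"
proof -
  have q: "qint 2 (- tpow 1) = 1 - tau True" "qint 2 (- tpow (- 1)) = 1 - tau False"
    by (simp_all add: qint_2 tau_def)
  \<comment> \<open>The recursion has depth two, so the continuant of the tail is carried along; its
    value 0 for the empty list is the convention \<open>K_{-1} = 0\<close>.\<close>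
  have "continuant (L ks) = (- 1) ^ length ks * fst (label_cfrac False ks) \<and>
    (if ks = [] then 0 else continuant (tl (L ks))) = (- 1) ^ length ks * snd (label_cfrac False ks)"
  proof (induction ks rule: even_cfrac.induct)
    case 1
    then show ?case by (simp add: L_def continuant_Nil)
  next
    case (2 k l ks)
    define P where "P = continuant (L ks)"
    define Q where "Q = (if ks = [] then 0 else continuant (tl (L ks)))"
    define X Y where "X = (1 - tau True) * of_int k" and "Y = - ((1 - tau False) * of_int l)"
    obtain x y where xy: "label_cfrac False ks = (x, y)" by fastforce
    have PQ: "P = (- 1) ^ length ks * x" "Q = (- 1) ^ length ks * y"
      using 2 unfolding P_def Q_def xy by simp_all
    have L: "L ((k, l) # ks) = X # Y # L ks"
      by (simp add: L_def X_def Y_def q flip: mult_minus_left)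
    have Q': "continuant (Y # L ks) = Y * P - Q"
    proof (cases ks rule: even_cfrac.cases)
      case 1
      then show ?thesis by (simp add: P_def Q_def L_def continuant_single continuant_Nil)
    next
      case (2 k' l' ks')
      then have "L ks \<noteq> []" by (simp add: L_def)
      then obtain z zs where "L ks = z # zs" by (meson neq_Nil_conv)
      then show ?thesis using 2 by (simp add: P_def Q_def continuant_Cons_Cons)
    qed
    have "continuant (X # Y # L ks) = X * (Y * P - Q) - P"
      unfolding continuant_Cons_Cons Q' P_def ..
    then show ?case
      unfolding L using Q' by (simp add: xy PQ X_def Y_def algebra_simps)
  qed
  then show ?thesis ..
qed

text \<open>Since \<open>1 - t^{-1} = - t^{-1} (1 - t)\<close>, exchanging the two factors only
  rescales the second component.\<close>

lemma label_cfrac_swap: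
  "fst (label_cfrac True ks) = fst (label_cfrac False ks) \<and>
   snd (label_cfrac True ks) = - tau True * snd (label_cfrac False ks)"
proof (induction ks rule: even_cfrac.induct)
  case (2 k l ks)
  obtain x y where "label_cfrac False ks = (x, y)" by fastforce
  moreover obtain x' y' where "label_cfrac True ks = (x', y')" by fastforce
  ultimately show ?case using 2 by (simp add: algebra_simps tau_cancel)
qed simp

subsection \<open>Determinants\<close>

text \<open>The adjugate turns \<open>A v = 0\<close> into \<open>det A * v = 0\<close>, and the
  entry 1 of \<open>v\<close> isolates \<open>det A\<close>; this works over any commutative
  ring.\<close>

lemma det_eq_0_right_null:
  fixes A :: "'a :: comm_ring_1 mat"
  assumes A: "A \<in> carrier_mat n n" and "j < n" and "v j = 1"
    and null: "\<And>i. i < n \<Longrightarrow> (\<Sum>k<n. A $$ (i, k) * v k) = 0"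
  shows "det A = 0"
proof -
  have "det A = (\<Sum>k<n. (adj_mat A * A) $$ (j, k) * v k)"
    unfolding adj_mat(3)[OF A] using \<open>j < n\<close> \<open>v j = 1\<close>
    by (simp add: if_distrib if_distribR sum.delta cong: if_cong)
  also have "\<dots> = (\<Sum>k<n. \<Sum>i<n. adj_mat A $$ (j, i) * (A $$ (i, k) * v k))"
    using adj_mat(1)[OF A] A \<open>j < n\<close>
    by (auto simp: scalar_prod_def sum_distrib_right atLeast0LessThan mult.assoc intro!: sum.cong)
  also have "\<dots> = (\<Sum>i<n. adj_mat A $$ (j, i) * (\<Sum>k<n. A $$ (i, k) * v k))"
    by (subst sum.swap) (simp add: sum_distrib_left)
  also have "\<dots> = 0"
    using null by simp
  finally show ?thesis .
qed

lemma det_eq_0_left_null: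
  fixes A :: "'a :: comm_ring_1 mat"
  assumes A: "A \<in> carrier_mat n n" and i: "i < n" "v i = 1"
    and null: "\<And>j. j < n \<Longrightarrow> (\<Sum>k<n. v k * A $$ (k, j)) = 0"
  shows "det A = 0"
proof -
  have "det (transpose_mat A) = 0"
    by (rule det_eq_0_right_null[of _ n i v]) (use assms in \<open>auto simp: mult.commute\<close>)
  then show ?thesis by (simp add: det_transpose[OF A])
qed

definition row_mat :: "nat \<Rightarrow> (nat \<Rightarrow> nat \<Rightarrow> 'a) \<Rightarrow> 'a mat" where
  "row_mat n r = mat n n (\<lambda>(i, j). r i j)"

lemma row_mat_carrier: "row_mat n r \<in> carrier_mat n n"
  by (simp add: row_mat_def)

lemma det_row_mat_cong:
  "(\<And>i j. i < n \<Longrightarrow> j < n \<Longrightarrow> r i j = r' i j) \<Longrightarrow> det (row_mat n r) = det (row_mat n r')"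
  unfolding row_mat_def by (rule arg_cong[of _ _ det]) (auto intro!: eq_matI)

lemma det_row_mat_expand:
  fixes r :: "nat \<Rightarrow> nat \<Rightarrow> 'a :: comm_ring_1"
  assumes i: "i < n"
  shows "det (row_mat n (r(i := f))) = (\<Sum>j<n. f j * cofactor (row_mat n r) i j)"
proof -
  have "mat_delete (row_mat n (r(i := f))) i j = mat_delete (row_mat n r) i j" for j
    using i by (intro eq_matI) (auto simp: mat_delete_def row_mat_def)
  then have "cofactor (row_mat n (r(i := f))) i j = cofactor (row_mat n r) i j" for j
    by (simp add: cofactor_def)
  then show ?thesis
    using i by (subst laplace_expansion_row[OF row_mat_carrier i]) (simp add: row_mat_def)
qed

lemma det_row_mat_linear:
  fixes r :: "nat \<Rightarrow> nat \<Rightarrow> 'a :: comm_ring_1"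
  assumes "i < n"
  shows "det (row_mat n (r(i := (\<lambda>j. a * f j + b * g j)))) =
    a * det (row_mat n (r(i := f))) + b * det (row_mat n (r(i := g)))"
  by (simp add: det_row_mat_expand[OF assms] algebra_simps sum.distrib sum_distrib_left)

lemma det_row_mat_swap:
  fixes r :: "nat \<Rightarrow> nat \<Rightarrow> 'a :: comm_ring_1"
  assumes "i < n" "k < n" "i \<noteq> k"
  shows "det (row_mat n (r(i := f, k := g))) = - det (row_mat n (r(i := g, k := f)))"
proof -
  have "row_mat n (r(i := f, k := g)) = swaprows i k (row_mat n (r(i := g, k := f)))"
    using assms by (auto simp: row_mat_def intro!: eq_matI)
  then show ?thesis using det_swaprows[OF assms row_mat_carrier] by simp
qed

definition indicator_row :: "nat \<Rightarrow> nat \<Rightarrow> laurent" where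
  "indicator_row a m = of_bool (m = a)"

lemma sum_indicator_row:
  "a < n \<Longrightarrow> (\<Sum>m<n. indicator_row a m * f m) = f a"
  by (simp add: indicator_row_def if_distrib[of "\<lambda>x. x * _"] of_bool_def cong: if_cong)

text \<open>Three moves: the row \<open>i\<close>, replaced by an indicator row, is recovered in the last row by the
  linear relation between the rows; the indicator row may be moved to column 0 because all other rows
  have sum 0; and applying the remaining rows to the labels leaves only \<open>l a\<close>.\<close>

lemma det_relation_rows:
  fixes N :: "nat \<Rightarrow> nat \<Rightarrow> laurent" and c :: nat
  defines "F \<equiv> \<lambda>f g. N(c := f, Suc c := g)"
  assumes sums: "\<And>k. k < c \<Longrightarrow> (\<Sum>m<c + 2. N k m) = 0"
    and labels: "\<And>k. k < c \<Longrightarrow> (\<Sum>m<c + 2. N k m * l m) = 0" "l 0 = 0" "l 1 = 1"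
    and units: "\<And>k. k < c \<Longrightarrow> tunit (y k)" "tunit w"
    and relation: "\<And>m. m < c + 2 \<Longrightarrow> (\<Sum>k<c. y k * N k m) =
      - (v * (indicator_row 0 m - indicator_row a m)) - w * (indicator_row b m - indicator_row d m)"
    and unimodular: "tunit (det (row_mat (c + 2) (F (indicator_row 1) (indicator_row 0))))"
    and ir: "i < c" "r < c + 2" "a < c + 2"
  shows "det (row_mat (c + 2) ((F (\<lambda>m. indicator_row 0 m - indicator_row a m)
      (\<lambda>m. indicator_row b m - indicator_row d m))(i := indicator_row r))) \<doteq> l a"
proof -
  let ?n = "c + 2"
  define D where "D r = det (row_mat ?n r)" for r :: "nat \<Rightarrow> nat \<Rightarrow> laurent"
  define p where "p m = indicator_row 0 m - indicator_row a m" for m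
  define q where "q m = indicator_row b m - indicator_row d m" for m
  define R where "R = (F p q)(i := indicator_row r)"
  have lin: "D (R(k := (\<lambda>j. \<alpha> * f j + \<beta> * g j))) = \<alpha> * D (R(k := f)) + \<beta> * D (R(k := g))"
    if "k < ?n" for R k \<alpha> \<beta> f g
    unfolding D_def using det_row_mat_linear[OF that] .
  have ir': "i < ?n" "i \<noteq> Suc c" "Suc c < ?n" using ir by auto
  have split: "(\<Sum>k<?n. f k) = (\<Sum>k<c. f k) + f c + f (Suc c)" for f :: "nat \<Rightarrow> laurent"
    by (simp add: numeral_2_eq_2)
  \<comment> \<open>The left null vector is read off from \<open>relation\<close>:
    \<open>y k\<close> on the other crossing rows, \<open>v\<close> on row \<open>c\<close>, 1 on
    the last row, and 0 on row \<open>i\<close>, whose former term now sits in the last row.\<close>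
  have "D (R(Suc c := (\<lambda>m. w * q m + y i * N i m))) = 0"
    unfolding D_def
  proof (rule det_eq_0_left_null[of _ ?n "Suc c" "\<lambda>k. if k < c then (if k = i then 0 else y k) else if k = c then v else 1"])
    fix j assume j: "j < ?n"
    have *: "(\<Sum>k<c. (if k = i then 0 else y k) * N k j) = (\<Sum>k<c. y k * N k j) - y i * N i j"
      using ir(1) by (subst (1 2) sum.remove[of _ i]) (auto intro!: sum.cong)
    have "(\<Sum>k<?n. (if k < c then (if k = i then 0 else y k) else if k = c then v else 1) *
        row_mat ?n (R(Suc c := (\<lambda>m. w * q m + y i * N i m))) $$ (k, j)) =
        (\<Sum>k<c. (if k = i then 0 else y k) * N k j) + v * p j + (w * q j + y i * N i j)"
      unfolding split using j ir by (auto simp: row_mat_def R_def F_def intro!: sum.cong)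
    also have "\<dots> = 0"
      unfolding * relation[OF j] by (simp add: p_def q_def)
    finally show "(\<Sum>k<?n. (if k < c then (if k = i then 0 else y k) else if k = c then v else 1) *
        row_mat ?n (R(Suc c := (\<lambda>m. w * q m + y i * N i m))) $$ (k, j)) = 0" .
  qed (simp_all add: row_mat_carrier)
  moreover have "R(Suc c := q) = R" using ir by (auto simp: R_def F_def)
  ultimately have step1: "w * D R + y i * D (R(Suc c := N i)) = 0"
    using lin[of "Suc c" R w q "y i" "N i"] by simp
  have "R(Suc c := N i) = (F p q)(i := indicator_row r, Suc c := N i)" by (simp add: R_def)
  moreover have "(F p q)(i := N i, Suc c := indicator_row r) = F p (indicator_row r)"
    using ir(1) by (auto simp: F_def)
  ultimately have step2: "D (R(Suc c := N i)) = - D (F p (indicator_row r))"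
    unfolding D_def using det_row_mat_swap[OF ir'(1,3,2), of "F p q"] by simp
  have "D ((F p q)(Suc c := (\<lambda>m. 1 * indicator_row r m + (- 1) * indicator_row 0 m))) = 0"
    unfolding D_def
  proof (rule det_eq_0_right_null[of _ ?n 0 "\<lambda>_. 1"])
    fix k assume k: "k < ?n"
    have pq: "(\<Sum>m<?n. p m) = 0"
      "(\<Sum>m<?n. 1 * indicator_row r m + (- 1) * indicator_row 0 m) = 0"
      using ir sum_indicator_row[of _ ?n "\<lambda>_. 1"] by (simp_all add: p_def sum_subtractf)
    show "(\<Sum>m<?n. row_mat ?n ((F p q)(Suc c := (\<lambda>m. 1 * indicator_row r m + (- 1) * indicator_row 0 m))) $$ (k, m) * 1) = 0"
      using k sums pq by (cases "k < c"; cases "k = c") (simp_all add: row_mat_def F_def)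
  qed (simp_all add: row_mat_carrier)
  moreover have "(F p q)(Suc c := g) = F p g" for g
    by (auto simp: F_def fun_eq_iff)
  ultimately have step3: "D (F p (indicator_row r)) = D (F p (indicator_row 0))"
    using lin[of "Suc c" "F p q" 1 "indicator_row r" "- 1" "indicator_row 0"] by simp
  \<comment> \<open>Applied to the labels, \<open>p\<close> gives \<open>l 0 - l a = - l a\<close>
    and \<open>indicator_row 1\<close> gives 1; the multiple \<open>l a\<close> is chosen to make
    \<open>l\<close> a null vector.\<close>
  have "D ((F p (indicator_row 0))(c := (\<lambda>m. 1 * p m + l a * indicator_row 1 m))) = 0"
    unfolding D_def
  proof (rule det_eq_0_right_null[of _ ?n 1 l])
    fix k assume k: "k < ?n"
    have "(\<Sum>m<?n. (1 * p m + l a * indicator_row 1 m) * l m) =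
        (\<Sum>m<?n. indicator_row 0 m * l m) - (\<Sum>m<?n. indicator_row a m * l m)
          + l a * (\<Sum>m<?n. indicator_row 1 m * l m)"
      by (simp only: p_def sum.distrib[symmetric] sum_subtractf[symmetric] sum_distrib_left)
        (simp add: algebra_simps)
    then have pq: "(\<Sum>m<?n. (1 * p m + l a * indicator_row 1 m) * l m) = 0"
      "(\<Sum>m<?n. indicator_row 0 m * l m) = 0"
      using ir labels(2,3) by (simp_all only: sum_indicator_row) simp_all
    show "(\<Sum>m<?n. row_mat ?n ((F p (indicator_row 0))(c := (\<lambda>m. 1 * p m + l a * indicator_row 1 m))) $$ (k, m) * l m) = 0"
      using k labels(1) pq by (cases "k < c"; cases "k = c") (simp_all add: row_mat_def F_def)
  qed (use labels in \<open>simp_all add: row_mat_carrier\<close>)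
  moreover have "(F p (indicator_row 0))(c := g) = F g (indicator_row 0)" for g
    by (auto simp: F_def fun_eq_iff)
  ultimately have step4: "D (F p (indicator_row 0)) = - (l a * D (F (indicator_row 1) (indicator_row 0)))"
    using lin[of c "F p (indicator_row 0)" 1 p "l a" "indicator_row 1"]
    by (simp add: eq_neg_iff_add_eq_0)
  obtain w' where w': "tunit w'" "w * w' = 1" using units(2) by (rule tunit_inverse)
  define u where "u = D (F (indicator_row 1) (indicator_row 0))"
  have u: "tunit u" using unimodular by (simp add: u_def D_def)
  have "w * D R = - (y i * u * l a)"
    using step1 unfolding step2 step3 step4 u_def[symmetric]
    by (simp add: eq_neg_iff_add_eq_0 algebra_simps)
  then have "w' * (w * D R) = (- (w' * y i * u)) * l a" by (simp add: mult.assoc)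
  moreover have "w' * (w * D R) = D R" using w'(2) by (metis mult.assoc mult.commute mult_1)
  ultimately show ?thesis
    using w'(1) u units(1)[OF ir(1)]
    by (intro unit_equivI[of "- (w' * y i * u)"])
      (auto simp: D_def R_def p_def[abs_def] q_def[abs_def] intro!: tunit_minus tunit_mult)
qed

lemma det_mat_2_2: "det (mat 2 2 F) = F (0, 0) * F (1, 1) - F (0, 1) * F (1, 0)"
  for F :: "nat \<times> nat \<Rightarrow> 'a :: comm_ring_1"
proof -
  have "det (mat (Suc 0) (Suc 0) G) = G (0, 0)" for G :: "nat \<times> nat \<Rightarrow> 'a"
    by (simp add: det_def)
  then show ?thesis
    by (subst laplace_expansion_row[of _ 2 0])
      (simp_all add: numeral_2_eq_2 cofactor_def mat_delete_def)
qed

text \<open>The matrix that adds up the columns with the same image under \<open>h\<close> (represented by the list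
  \<open>cs\<close>), completed to a square matrix by the two columns \<open>p\<close> and \<open>q\<close> that disappear.\<close>

definition quotient_mat :: "nat \<Rightarrow> (nat \<Rightarrow> nat) \<Rightarrow> nat list \<Rightarrow> nat \<Rightarrow> nat \<Rightarrow> 'a :: comm_ring_1 mat" where
  "quotient_mat c h cs p q = row_mat (c + 2) (\<lambda>m j. if j < c then of_bool (h m = cs ! j)
     else if j = c then of_bool (m = p) else of_bool (m = q))"

text \<open>The rows \<open>f\<close> and \<open>g\<close> sum to 0 over each fibre of
  \<open>h\<close> that is represented in \<open>cs\<close>, so the product with
  \<open>quotient_mat\<close> is block triangular.\<close>

lemma det_quotient:
  fixes r :: "nat \<Rightarrow> nat \<Rightarrow> 'a :: idom" and f g :: "nat \<Rightarrow> 'a" and c :: nat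
  assumes f: "\<And>j. j < c \<Longrightarrow> (\<Sum>m<c + 2. f m * of_bool (h m = cs ! j)) = 0"
    and g: "\<And>j. j < c \<Longrightarrow> (\<Sum>m<c + 2. g m * of_bool (h m = cs ! j)) = 0"
    and pq: "p < c + 2" "q < c + 2"
  shows "det (row_mat (c + 2) (r(c := f, Suc c := g))) * det (quotient_mat c h cs p q) =
    det (row_mat c (\<lambda>i j. \<Sum>m<c + 2. r i m * of_bool (h m = cs ! j))) * (f p * g q - f q * g p)"
proof -
  let ?n = "c + 2"
  let ?R = "r(c := f, Suc c := g)"
  let ?A = "row_mat c (\<lambda>i j. \<Sum>m<?n. r i m * of_bool (h m = cs ! j))"
  let ?B = "mat c 2 (\<lambda>(i, j). r i (if j = 0 then p else q))"
  let ?D = "mat 2 2 (\<lambda>(i, j). (if i = 0 then f else g) (if j = 0 then p else q))"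
  have "row_mat ?n ?R * quotient_mat c h cs p q = four_block_mat ?A ?B (0\<^sub>m 2 c) ?D"
  proof (rule eq_matI)
    fix i j
    assume "i < dim_row (four_block_mat ?A ?B (0\<^sub>m 2 c) ?D)" "j < dim_col (four_block_mat ?A ?B (0\<^sub>m 2 c) ?D)"
    then have ij: "i < ?n" "j < ?n" by (simp_all add: row_mat_def)
    have "(row_mat ?n ?R * quotient_mat c h cs p q) $$ (i, j) =
        (\<Sum>m<?n. ?R i m * (if j < c then of_bool (h m = cs ! j)
          else if j = c then of_bool (m = p) else of_bool (m = q)))"
      using ij by (auto simp: quotient_mat_def row_mat_def scalar_prod_def atLeast0LessThan intro!: sum.cong)
    also have "\<dots> = (if j < c then \<Sum>m<?n. ?R i m * of_bool (h m = cs ! j)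
        else ?R i (if j = c then p else q))"
      using pq by (simp add: of_bool_def if_distrib[of "\<lambda>x. _ * x"] cong: if_cong)
    also have "\<dots> = four_block_mat ?A ?B (0\<^sub>m 2 c) ?D $$ (i, j)"
      using ij f g by (auto simp: row_mat_def)
    finally show "(row_mat ?n ?R * quotient_mat c h cs p q) $$ (i, j) =
      four_block_mat ?A ?B (0\<^sub>m 2 c) ?D $$ (i, j)" .
  qed (simp_all add: row_mat_def quotient_mat_def)
  then have "det (row_mat ?n ?R) * det (quotient_mat c h cs p q) = det (four_block_mat ?A ?B (0\<^sub>m 2 c) ?D)"
    using det_mult[of "row_mat ?n ?R" ?n "quotient_mat c h cs p q"]
    by (simp add: row_mat_carrier quotient_mat_def)
  also have "\<dots> = det ?A * det ?D"
    by (rule det_four_block_mat_lower_left_zero[where n = c and m = 2]) (simp_all add: row_mat_carrier)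
  also have "det ?D = f p * g q - f q * g p"
    by (simp add: det_mat_2_2)
  finally show ?thesis .
qed

text \<open>The minor is, up to sign, the determinant with row \<open>i\<close> replaced by a unit
  row, and that unit row is the image of \<open>indicator_row (cs ! j)\<close> under the merging of
  columns.\<close>

lemma det_mat_delete_quotient:
  fixes N :: "nat \<Rightarrow> nat \<Rightarrow> laurent" and c :: nat and f g :: "nat \<Rightarrow> int"
  assumes f: "\<And>j. j < c \<Longrightarrow> (\<Sum>m<c + 2. f m * of_bool (h m = cs ! j)) = 0"
    and g: "\<And>j. j < c \<Longrightarrow> (\<Sum>m<c + 2. g m * of_bool (h m = cs ! j)) = 0"
    and pq: "p < c + 2" "q < c + 2" "f p * g q - f q * g p = 1"
    and cs: "length cs = c" "distinct cs" "\<And>x. x \<in> set cs \<Longrightarrow> x < c + 2 \<and> h x = x"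
    and ij: "i < c" "j < c"
  shows "det (mat_delete (row_mat c (\<lambda>i j. \<Sum>m<c + 2. N i m * of_bool (h m = cs ! j))) i j) \<doteq>
    det (row_mat (c + 2) ((N(c := (\<lambda>m. of_int (f m)), Suc c := (\<lambda>m. of_int (g m))))
      (i := indicator_row (cs ! j))))"
proof -
  let ?n = "c + 2"
  let ?S = "quotient_mat c h cs p q :: int mat" and ?S' = "quotient_mat c h cs p q :: laurent mat"
  let ?f = "\<lambda>m. of_int (f m) :: laurent" and ?g = "\<lambda>m. of_int (g m) :: laurent"
  have delta: "(\<Sum>m<?n. of_bool (m = cs ! k) * of_bool (h m = cs ! l)) = (of_bool (l = k) :: 'b :: comm_ring_1)"
    if "k < c" "l < c" for k l
  proof -
    have ck: "cs ! k < ?n" "h (cs ! k) = cs ! k" using cs that by auto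
    have "(\<Sum>m<?n. of_bool (m = cs ! k) * of_bool (h m = cs ! l)) =
        (\<Sum>m<?n. if m = cs ! k then of_bool (h m = cs ! l) else (0 :: 'b))"
      by (rule sum.cong) auto
    also have "\<dots> = of_bool (cs ! k = cs ! l)" using ck by simp
    also have "(cs ! k = cs ! l) \<longleftrightarrow> l = k" using cs that nth_eq_iff_index_eq[of cs] by auto
    finally show ?thesis .
  qed
  \<comment> \<open>With the indicator rows of the representatives in place of \<open>N\<close>, the
    merged matrix is the identity, so \<open>det ?S\<close> divides 1.\<close>
  have "det (row_mat ?n ((\<lambda>k m. of_bool (m = cs ! k))(c := f, Suc c := g))) * det ?S =
      det (row_mat c (\<lambda>k l. \<Sum>m<?n. of_bool (m = cs ! k) * of_bool (h m = cs ! l)))"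
    by (rule trans[OF det_quotient[OF f g pq(1,2)]]) (simp_all only: pq(3) mult_1_right)
  also have "row_mat c (\<lambda>k l. \<Sum>m<?n. of_bool (m = cs ! k) * of_bool (h m = cs ! l)) = (1\<^sub>m c :: int mat)"
    by (rule eq_matI) (simp_all only: row_mat_def delta dim_row_mat dim_col_mat index_mat index_one_mat case_prod_conv, auto)
  \<comment> \<open>Working over the integers shows that this unit is a sign.\<close>
  finally have "det ?S dvd 1" by (metis det_one dvd_triv_right)
  then have "det ?S = 1 \<or> det ?S = - 1" by auto
  moreover have "?S' = map_mat of_int ?S"
    by (auto simp: quotient_mat_def row_mat_def intro!: eq_matI)
  ultimately have S': "det ?S' = 1 \<or> det ?S' = - 1" by (auto simp: of_int_hom.hom_det)
  let ?M = "\<lambda>N. row_mat c (\<lambda>i j. \<Sum>m<?n. N i m * of_bool (h m = cs ! j)) :: laurent mat"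
  let ?N = "N(i := indicator_row (cs ! j))"
  have upd: "(N(c := ?f, Suc c := ?g))(i := indicator_row (cs ! j)) = ?N(c := ?f, Suc c := ?g)"
    using ij by auto
  have *: "(\<Sum>m<?n. of_int (e m) * of_bool (h m = cs ! l)) =
      (of_int (\<Sum>m<?n. e m * of_bool (h m = cs ! l)) :: laurent)" for e :: "nat \<Rightarrow> int" and l
    by simp
  have ff: "(\<Sum>m<?n. ?f m * of_bool (h m = cs ! l)) = 0" "(\<Sum>m<?n. ?g m * of_bool (h m = cs ! l)) = 0"
    if "l < c" for l
    using f[OF that] g[OF that] by (simp_all only: * of_int_0)
  have "?f p * ?g q - ?f q * ?g p = 1"
    using arg_cong[OF pq(3), of of_int] by simp
  then have "det (row_mat ?n (?N(c := ?f, Suc c := ?g))) * det ?S' = det (?M ?N)"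
    by (intro trans[OF det_quotient[OF ff pq(1,2)]]) (simp_all only: mult_1_right)
  also have "\<dots> = det (row_mat c ((\<lambda>i j. \<Sum>m<?n. N i m * of_bool (h m = cs ! j))(i := (\<lambda>l. of_bool (l = j)))))"
  proof (rule det_row_mat_cong)
    fix k l assume "k < c" "l < c"
    show "(\<Sum>m<?n. ?N k m * of_bool (h m = cs ! l)) =
        ((\<lambda>i j. \<Sum>m<?n. N i m * of_bool (h m = cs ! j))(i := (\<lambda>l. of_bool (l = j)))) k l"
      using delta[OF ij(2) \<open>l < c\<close>] by (cases "k = i") (simp_all only: fun_upd_apply indicator_row_def simp_thms if_True if_False)
  qed
  also have "\<dots> = cofactor (?M N) i j"
    using ij by (simp add: det_row_mat_expand of_bool_def if_distrib[of "\<lambda>x. x * _"] cong: if_cong)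
  finally have cof: "cofactor (?M N) i j = det ?S' * det (row_mat ?n (?N(c := ?f, Suc c := ?g)))"
    by (simp add: mult.commute)
  have "(- 1) ^ (i + j) * (- 1) ^ (i + j) = (1 :: laurent)"
    by (cases "even (i + j)") simp_all
  then have "det (mat_delete (?M N) i j) = (- 1) ^ (i + j) * cofactor (?M N) i j"
    by (simp only: cofactor_def mult.assoc[symmetric] mult_1)
  then have "det (mat_delete (?M N) i j) =
      ((- 1) ^ (i + j) * det ?S') * det (row_mat ?n (?N(c := ?f, Suc c := ?g)))"
    unfolding cof by (simp only: mult.assoc)
  moreover have "tunit ((- 1) ^ (i + j) * det ?S')"
    using S' by (auto intro!: tunit_mult tunit_minus_1_power tunit_1 tunit_minus)
  ultimately show ?thesis unfolding upd by (rule unit_equivI[rotated])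
qed

subsection \<open>Rational tangles\<close>

definition crossing_arcs :: "crossing \<Rightarrow> nat set" where
  "crossing_arcs x = {over x, left x, right x}"

definition tangle_ends :: "tangle \<Rightarrow> nat set" where
  "tangle_ends T = {fst (nw T), fst (ne T), fst (sw T), fst (se T)}"

lemmas twist_defs = right_twist_def bottom_twist_def crossing_under_def Let_def

lemma rational_tangle_arcs:
  assumes "rational_tangle T a b"
  shows "fst (nw T) = 0" and "tangle_ends T \<subseteq> {..<length (crossings T) + 2}"
    and "\<And>x. x \<in> set (crossings T) \<Longrightarrow> crossing_arcs x \<subseteq> {..<length (crossings T) + 2}"
proof -
  have "fst (nw T) = 0 \<and> tangle_ends T \<subseteq> {..<length (crossings T) + 2} \<and>
      (\<forall>x \<in> set (crossings T). crossing_arcs x \<subseteq> {..<length (crossings T) + 2})"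
    using assms
    by (induction rule: rational_tangle.induct)
      (auto simp: zero_tangle_def infinity_tangle_def twist_defs fresh_arc_def
        tangle_ends_def crossing_arcs_def less_SucI)
  then show "fst (nw T) = 0" "tangle_ends T \<subseteq> {..<length (crossings T) + 2}"
    "\<And>x. x \<in> set (crossings T) \<Longrightarrow> crossing_arcs x \<subseteq> {..<length (crossings T) + 2}"
    by blast+
qed

lemma rational_tangle_fresh:
  assumes "rational_tangle T a b"
  shows "fst (nw T) \<noteq> fresh_arc T" "fst (ne T) \<noteq> fresh_arc T"
    "fst (sw T) \<noteq> fresh_arc T" "fst (se T) \<noteq> fresh_arc T"
    "x \<in> set (crossings T) \<Longrightarrow> over x \<noteq> fresh_arc T \<and> left x \<noteq> fresh_arc T \<and> right x \<noteq> fresh_arc T"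
  using rational_tangle_arcs[OF assms]
  by (force simp: fresh_arc_def tangle_ends_def crossing_arcs_def)+

lemma fresh_arc_neq: "fresh_arc T \<noteq> 0" "fresh_arc T \<noteq> 1" "0 \<noteq> fresh_arc T" "1 \<noteq> fresh_arc T"
  "fresh_arc T \<noteq> Suc 0" "Suc 0 \<noteq> fresh_arc T"
  by (simp_all add: fresh_arc_def)

text \<open>The colouring below is the specialization at $t = -1$ of the Alexander labelling of the
  tangle.  It recovers the fraction and thereby shows that the closure identifies exactly two pairs
  of arcs.\<close>

lemma rational_tangle_coloring:
  assumes "rational_tangle T a b"
  shows "\<exists>l :: nat \<Rightarrow> int. l 0 = 0 \<and> l (fst (ne T)) = a \<and> l (fst (sw T)) = b \<and> l (fst (se T)) = a + b"
  using assms
proof (induction rule: rational_tangle.induct)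
  case (1 x y)
  show ?case by (rule exI[of _ "\<lambda>m. if m = 0 then 0 else 1"]) (simp add: zero_tangle_def)
next
  case (2 x y)
  show ?case by (rule exI[of _ "\<lambda>m. if m = 0 then 0 else 1"]) (simp add: infinity_tangle_def)
next
  case (3 T a b s)
  then obtain l :: "nat \<Rightarrow> int" where
    "l 0 = 0" "l (fst (ne T)) = a" "l (fst (sw T)) = b" "l (fst (se T)) = a + b" by blast
  \<comment> \<open>At t = -1 the new label is twice the over-arc minus the old under-arc:
    \<open>2 * (a + b) - a\<close> or \<open>2 * a - (a + b)\<close>.\<close>
  then show ?case using rational_tangle_fresh[OF 3(1)]
    by (intro exI[of _ "l(fresh_arc T := (if s then a + 2 * b else a - b))"])
      (auto simp: twist_defs fresh_arc_neq)
next
  case (4 T a b s)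
  then obtain l :: "nat \<Rightarrow> int" where
    "l 0 = 0" "l (fst (ne T)) = a" "l (fst (sw T)) = b" "l (fst (se T)) = a + b" by blast
  then show ?case using rational_tangle_fresh[OF 4(1)]
    by (intro exI[of _ "l(fresh_arc T := (if s then 2 * a + b else b - a))"])
      (auto simp: twist_defs fresh_arc_neq)
qed

lemma crossing_arcs_under: "crossing_arcs (crossing_under e l r) = {fst e, l, r}"
  by (auto simp: crossing_arcs_def crossing_under_def)

text \<open>The arcs of a diagram are collected from its crossings. An arc of the tangle that meets
  none of them reaches an end, where the closure glues it to another arc.\<close>

lemma rational_tangle_arc_cover:
  assumes "rational_tangle T a b"
  shows "{..<length (crossings T) + 2} \<subseteq> tangle_ends T \<union> (\<Union>x \<in> set (crossings T). crossing_arcs x)"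
  using assms
proof (induction rule: rational_tangle.induct)
  case (3 T a b s)
  let ?T = "right_twist s T"
  have sub: "insert (fresh_arc T) (tangle_ends T \<union> (\<Union>x \<in> set (crossings T). crossing_arcs x)) \<subseteq>
      tangle_ends ?T \<union> (\<Union>x \<in> set (crossings ?T). crossing_arcs x)"
    by (cases s) (simp_all add: right_twist_def bottom_twist_def Let_def tangle_ends_def crossing_arcs_under, (intro subset_insertI2 subset_refl)+)
  have len: "{..<length (crossings ?T) + 2} = insert (fresh_arc T) {..<length (crossings T) + 2}"
    by (cases s) (simp_all add: right_twist_def bottom_twist_def Let_def fresh_arc_def lessThan_Suc)
  show ?case unfolding len by (rule order_trans[OF insert_mono[OF 3(2)] sub])
next
  case (4 T a b s)
  let ?T = "bottom_twist s T"
  have sub: "insert (fresh_arc T) (tangle_ends T \<union> (\<Union>x \<in> set (crossings T). crossing_arcs x)) \<subseteq>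
      tangle_ends ?T \<union> (\<Union>x \<in> set (crossings ?T). crossing_arcs x)"
    by (cases s) (simp_all add: right_twist_def bottom_twist_def Let_def tangle_ends_def crossing_arcs_under, (intro subset_insertI2 subset_refl)+)
  have len: "{..<length (crossings ?T) + 2} = insert (fresh_arc T) {..<length (crossings T) + 2}"
    by (cases s) (simp_all add: right_twist_def bottom_twist_def Let_def fresh_arc_def lessThan_Suc)
  show ?case unfolding len by (rule order_trans[OF insert_mono[OF 4(2)] sub])
qed (simp_all add: zero_tangle_def infinity_tangle_def tangle_ends_def numeral_2_eq_2 lessThan_Suc)

text \<open>The first twist involves only the arcs 0 and 1, so they cannot both miss all
  crossings.\<close>

lemma rational_tangle_base_arc:
  assumes "rational_tangle T a b"
  shows "if crossings T = [] then a = 0 \<or> b = 0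
    else {0, 1} \<inter> (\<Union>x \<in> set (crossings T). crossing_arcs x) \<noteq> {}"
  using assms
proof (induction rule: rational_tangle.induct)
  case (3 T a b s)
  show ?case
  proof (cases "crossings T = []")
    case True
    then have "tangle_ends T \<subseteq> {0, 1}" using rational_tangle_arcs(2)[OF 3(1)] by auto
    then show ?thesis by (auto simp: twist_defs crossing_arcs_def tangle_ends_def)
  qed (use 3 in \<open>auto simp: twist_defs\<close>)
next
  case (4 T a b s)
  show ?case
  proof (cases "crossings T = []")
    case True
    then have "tangle_ends T \<subseteq> {0, 1}" using rational_tangle_arcs(2)[OF 4(1)] by auto
    then show ?thesis by (auto simp: twist_defs crossing_arcs_def tangle_ends_def)
  qed (use 4 in \<open>auto simp: twist_defs\<close>)
qed (simp_all add: zero_tangle_def infinity_tangle_def)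

lemma alexander_entry_indicator:
  "alexander_entry x m = (1 - tpow 1) * indicator_row (over x) m + tpow 1 * indicator_row (left x) m
     - indicator_row (right x) m"
  by (auto simp: alexander_entry_def indicator_row_def)

lemma sum_alexander_entry:
  assumes "crossing_arcs x \<subseteq> {..<n}"
  shows "(\<Sum>m<n. alexander_entry x m * f m) =
    (1 - tpow 1) * f (over x) + tpow 1 * f (left x) - f (right x)"
proof -
  have "(\<Sum>m<n. alexander_entry x m * f m) =
      (1 - tpow 1) * (\<Sum>m<n. indicator_row (over x) m * f m)
      + tpow 1 * (\<Sum>m<n. indicator_row (left x) m * f m) - (\<Sum>m<n. indicator_row (right x) m * f m)"
    by (simp only: alexander_entry_indicator sum.distrib[symmetric] sum_subtractf[symmetric] sum_distrib_left)
      (rule sum.cong, simp_all add: algebra_simps)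
  then show ?thesis using assms by (simp add: sum_indicator_row crossing_arcs_def)
qed

definition tangle_state :: "tangle \<Rightarrow> (nat \<Rightarrow> laurent) \<Rightarrow> state" where
  "tangle_state T l = State (snd (nw T)) (snd (ne T)) (snd (sw T)) (snd (se T))
     (l (fst (ne T))) (l (fst (sw T))) (l (fst (se T)))"

lemma tpow_tau: "tpow 1 = tau True"
  by (simp add: tau_def)

lemma rational_tangle_labels:
  assumes "rational_tangle T a b"
  shows "\<exists>l. l 0 = 0 \<and> l 1 = 1 \<and>
    (\<forall>x \<in> set (crossings T). (1 - tpow 1) * l (over x) + tpow 1 * l (left x) - l (right x) = 0) \<and>
    reachable (tangle_state T l) a b"
  using assms
proof (induction rule: rational_tangle.induct)
  case (1 x y)
  show ?case using reachable.zero[of x y]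
    by (intro exI[of _ "\<lambda>m. if m = 0 then 0 else 1"]) (simp add: zero_tangle_def tangle_state_def)
next
  case (2 x y)
  show ?case using reachable.infinity[of x y]
    by (intro exI[of _ "\<lambda>m. if m = 0 then 0 else 1"]) (simp add: infinity_tangle_def tangle_state_def)
next
  case (3 T a b s)
  then obtain l where l: "l 0 = 0" "l 1 = 1"
    "\<And>x. x \<in> set (crossings T) \<Longrightarrow> (1 - tpow 1) * l (over x) + tpow 1 * l (left x) - l (right x) = 0"
    "reachable (tangle_state T l) a b" by blast
  define v where "v = (if s then (1 - tau (snd (se T))) * l (fst (se T)) + tau (snd (se T)) * l (fst (ne T))
    else (1 - tau (\<not> snd (ne T))) * l (fst (ne T)) + tau (\<not> snd (ne T)) * l (fst (se T)))"
  let ?l = "l(fresh_arc T := v)"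
  note fresh = rational_tangle_fresh[OF 3(1)]
  have "tangle_state (right_twist s T) ?l = rtwist s (tangle_state T l)"
    using fresh by (cases s) (auto simp: twist_defs tangle_state_def v_def)
  then have "reachable (tangle_state (right_twist s T) ?l) (if s then a + b else a - b) b"
    using reachable_rtwist[OF l(4)] by simp
  moreover have "(1 - tpow 1) * ?l (over x) + tpow 1 * ?l (left x) - ?l (right x) = 0"
    if "x \<in> set (crossings (right_twist s T))" for x
  proof (cases "x \<in> set (crossings T)")
    case True
    then show ?thesis using l(3) fresh by simp
  next
    case False
    then have "x = hd (crossings (right_twist s T))" using that by (auto simp: twist_defs)
    then show ?thesis using fresh
      by (cases s; cases "snd (se T)"; cases "snd (ne T)")
        (simp_all add: twist_defs v_def tpow_tau tau_cancel algebra_simps)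
  qed
  moreover have "?l 0 = 0" "?l 1 = 1" using l(1,2) by (simp_all add: fresh_arc_neq)
  ultimately show ?case by blast
next
  case (4 T a b s)
  then obtain l where l: "l 0 = 0" "l 1 = 1"
    "\<And>x. x \<in> set (crossings T) \<Longrightarrow> (1 - tpow 1) * l (over x) + tpow 1 * l (left x) - l (right x) = 0"
    "reachable (tangle_state T l) a b" by blast
  define v where "v = (if s then (1 - tau (\<not> snd (se T))) * l (fst (se T)) + tau (\<not> snd (se T)) * l (fst (sw T))
    else (1 - tau (snd (sw T))) * l (fst (sw T)) + tau (snd (sw T)) * l (fst (se T)))"
  let ?l = "l(fresh_arc T := v)"
  note fresh = rational_tangle_fresh[OF 4(1)]
  have "tangle_state (bottom_twist s T) ?l = btwist s (tangle_state T l)"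
    using fresh by (cases s) (auto simp: twist_defs tangle_state_def v_def)
  then have "reachable (tangle_state (bottom_twist s T) ?l) a (if s then b + a else b - a)"
    using reachable_btwist[OF l(4)] by simp
  moreover have "(1 - tpow 1) * ?l (over x) + tpow 1 * ?l (left x) - ?l (right x) = 0"
    if "x \<in> set (crossings (bottom_twist s T))" for x
  proof (cases "x \<in> set (crossings T)")
    case True
    then show ?thesis using l(3) fresh by simp
  next
    case False
    then have "x = hd (crossings (bottom_twist s T))" using that by (auto simp: twist_defs)
    then show ?thesis using fresh
      by (cases s; cases "snd (se T)"; cases "snd (sw T)")
        (simp_all add: twist_defs v_def tpow_tau tau_cancel algebra_simps)
  qed
  moreover have "?l 0 = 0" "?l 1 = 1" using l(1,2) by (simp_all add: fresh_arc_neq)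
  ultimately show ?case by blast
qed

text \<open>The Fox derivative of the product of the meridians at the ends NW, NE, SE, SW.  The boundary
  curve bounds a disc containing all crossings, so this is a combination of the crossing rows; every
  crossing occurs with a unit coefficient.\<close>

definition weight :: "bool \<Rightarrow> laurent \<Rightarrow> laurent" where
  "weight b g = (if b then g else - (tau True * g))"

text \<open>The image of the prefix of the boundary word: an incoming end contributes a meridian, an
  outgoing end its inverse. Their Fox derivatives 1 and \<open>- t^{-1}\<close>, multiplied by the
  common unit \<open>- t\<close>, are the factors in \<open>weight\<close>.\<close>

definition advance :: "bool \<Rightarrow> laurent \<Rightarrow> laurent" where
  "advance b g = (if b then tau False * g else tau True * g)"

definition end_weights :: "tangle \<Rightarrow> laurent \<times> laurent \<times> laurent \<times> laurent" where
  "end_weights T =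
     (let g1 = advance (snd (nw T)) 1; g2 = advance (snd (ne T)) g1; g3 = advance (snd (se T)) g2
      in (weight (snd (nw T)) 1, weight (snd (ne T)) g1, weight (snd (se T)) g2, weight (snd (sw T)) g3))"

definition boundary :: "tangle \<Rightarrow> nat \<Rightarrow> laurent" where
  "boundary T m = (case end_weights T of (w1, w2, w3, w4) \<Rightarrow>
     w1 * indicator_row (fst (nw T)) m + w2 * indicator_row (fst (ne T)) m
     + w3 * indicator_row (fst (se T)) m + w4 * indicator_row (fst (sw T)) m)"

lemma tunit_weight: "tunit g \<Longrightarrow> tunit (weight b g)"
  by (simp add: weight_def tunit_minus tunit_mult tunit_tau)

lemma tunit_advance: "tunit g \<Longrightarrow> tunit (advance b g)"
  by (simp add: advance_def tunit_mult tunit_tau)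

definition new_crossing :: "tangle \<Rightarrow> crossing" where
  "new_crossing T = hd (crossings T)"

text \<open>The boundary words before and after the twist differ by a conjugate of the crossing
  relator or of its inverse.\<close>

lemma boundary_right_twist:
  "\<exists>u. tunit u \<and> (\<forall>m. boundary (right_twist s T) m =
     u * alexander_entry (new_crossing (right_twist s T)) m + boundary T m)"
proof -
  define g where "g = advance (snd (nw T)) 1"
  have g: "tunit g" by (simp add: g_def tunit_advance tunit_1)
  \<comment> \<open>\<open>u\<close> is read off at the arc created by the twist: its weight divided
    by its entry in the crossing row, which is t on the left and -1 on the right.\<close>
  define u where "u = (if s
    then (if snd (se T) then - 1 else tau False) * weight (snd (ne T)) (advance (snd (se T)) g)
    else (if snd (ne T) then tau False else - 1) * weight (snd (se T)) g)"
  have "tunit u"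
    using g by (simp add: u_def tunit_weight tunit_advance tunit_minus tunit_mult tunit_tau)
  moreover have "boundary (right_twist s T) m =
     u * alexander_entry (new_crossing (right_twist s T)) m + boundary T m" for m
    unfolding boundary_def end_weights_def alexander_entry_indicator tpow_tau u_def g_def
      new_crossing_def
    by (cases s; cases "snd (nw T)"; cases "snd (ne T)"; cases "snd (se T)")
      (simp_all add: twist_defs weight_def advance_def tau_cancel algebra_simps)
  ultimately show ?thesis by blast
qed

lemma boundary_bottom_twist:
  "\<exists>u. tunit u \<and> (\<forall>m. boundary (bottom_twist s T) m =
     u * alexander_entry (new_crossing (bottom_twist s T)) m + boundary T m)"
proof -
  define g where "g = advance (snd (ne T)) (advance (snd (nw T)) 1)"
  have g: "tunit g" by (simp add: g_def tunit_advance tunit_1)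
  define u where "u = (if s
    then (if snd (se T) then tau False else - 1) * weight (snd (sw T)) g
    else (if snd (sw T) then - 1 else tau False) * weight (snd (se T)) (advance (snd (sw T)) g))"
  have "tunit u"
    using g by (simp add: u_def tunit_weight tunit_advance tunit_minus tunit_mult tunit_tau)
  moreover have "boundary (bottom_twist s T) m =
     u * alexander_entry (new_crossing (bottom_twist s T)) m + boundary T m" for m
    unfolding boundary_def end_weights_def alexander_entry_indicator tpow_tau u_def g_def
      new_crossing_def
    by (cases s; cases "snd (nw T)"; cases "snd (ne T)"; cases "snd (sw T)"; cases "snd (se T)")
      (simp_all add: twist_defs weight_def advance_def tau_cancel algebra_simps)
  ultimately show ?thesis by blast
qed

lemma rational_tangle_boundary:
  assumes "rational_tangle T a b"
  shows "\<exists>y. (\<forall>k < length (crossings T). tunit (y k)) \<and>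
    (\<forall>m. (\<Sum>k<length (crossings T). y k * alexander_entry (crossings T ! k) m) = boundary T m)"
  using assms
proof (induction rule: rational_tangle.induct)
  case (1 x y)
  show ?case by (simp add: zero_tangle_def boundary_def end_weights_def weight_def advance_def Let_def
    algebra_simps tau_cancel)
next
  case (2 x y)
  show ?case by (simp add: infinity_tangle_def boundary_def end_weights_def weight_def advance_def Let_def
    algebra_simps tau_cancel)
next
  case (3 T a b s)
  then obtain y where y: "\<And>k. k < length (crossings T) \<Longrightarrow> tunit (y k)"
    "\<And>m. (\<Sum>k<length (crossings T). y k * alexander_entry (crossings T ! k) m) = boundary T m"
    by blast
  obtain u where u: "tunit u" "\<And>m. boundary (right_twist s T) m =
     u * alexander_entry (new_crossing (right_twist s T)) m + boundary T m"
    using boundary_right_twist by blast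
  have cr: "crossings (right_twist s T) = new_crossing (right_twist s T) # crossings T"
    by (simp add: new_crossing_def right_twist_def Let_def)
  show ?case
    using y u unfolding cr
    by (intro exI[of _ "case_nat u y"])
      (simp add: sum.lessThan_Suc_shift less_Suc_eq_0_disj del: sum.lessThan_Suc, auto)
next
  case (4 T a b s)
  then obtain y where y: "\<And>k. k < length (crossings T) \<Longrightarrow> tunit (y k)"
    "\<And>m. (\<Sum>k<length (crossings T). y k * alexander_entry (crossings T ! k) m) = boundary T m"
    by blast
  obtain u where u: "tunit u" "\<And>m. boundary (bottom_twist s T) m =
     u * alexander_entry (new_crossing (bottom_twist s T)) m + boundary T m"
    using boundary_bottom_twist by blast
  have cr: "crossings (bottom_twist s T) = new_crossing (bottom_twist s T) # crossings T"
    by (simp add: new_crossing_def bottom_twist_def Let_def)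
  show ?case
    using y u unfolding cr
    by (intro exI[of _ "case_nat u y"])
      (simp add: sum.lessThan_Suc_shift less_Suc_eq_0_disj del: sum.lessThan_Suc, auto)
qed

definition label_mat :: "crossing list \<Rightarrow> laurent mat" where
  "label_mat xs = row_mat (length xs + 2) ((\<lambda>k. alexander_entry (xs ! k))
     (length xs := indicator_row 1, Suc (length xs) := indicator_row 0))"

text \<open>The newest arc occurs neither in older crossings nor in the two indicator rows, so its
  column has a single nonzero entry, which is a unit.\<close>

lemma tunit_det_label_mat_Cons:
  assumes old: "\<And>y. y \<in> set xs \<Longrightarrow> crossing_arcs y \<subseteq> {..<length xs + 2}"
    and new: "tunit (alexander_entry x (length xs + 2))"
    and det: "tunit (det (label_mat xs))"
  shows "tunit (det (label_mat (x # xs)))"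
proof -
  let ?c = "length xs"
  let ?A = "label_mat (x # xs)"
  have A: "?A \<in> carrier_mat (Suc (?c + 2)) (Suc (?c + 2))"
    by (simp add: label_mat_def row_mat_def)
  have zero: "alexander_entry y (?c + 2) = 0" if "y \<in> set xs" for y
    using old[OF that] by (auto simp: alexander_entry_def crossing_arcs_def)
  have col: "?A $$ (Suc i, ?c + 2) = 0" if "i < ?c + 2" for i
    using that zero[OF nth_mem, of i] by (auto simp: label_mat_def row_mat_def indicator_row_def)
  have "mat_delete ?A 0 (?c + 2) = label_mat xs"
    by (rule eq_matI) (auto simp: label_mat_def row_mat_def mat_delete_def)
  then have cof: "cofactor ?A 0 (?c + 2) = (- 1) ^ (?c + 2) * det (label_mat xs)"
    by (simp add: cofactor_def)
  have "det ?A = (\<Sum>i<Suc (?c + 2). ?A $$ (i, ?c + 2) * cofactor ?A i (?c + 2))"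
    by (rule laplace_expansion_column[OF A]) simp
  also have "\<dots> = ?A $$ (0, ?c + 2) * cofactor ?A 0 (?c + 2) +
      (\<Sum>i<?c + 2. ?A $$ (Suc i, ?c + 2) * cofactor ?A (Suc i) (?c + 2))"
    by (rule sum.lessThan_Suc_shift)
  also have "(\<Sum>i<?c + 2. ?A $$ (Suc i, ?c + 2) * cofactor ?A (Suc i) (?c + 2)) = 0"
    by (rule sum.neutral, rule ballI, simp only: col lessThan_iff mult_zero_left)
  also have "?A $$ (0, ?c + 2) = alexander_entry x (?c + 2)"
    by (simp add: label_mat_def row_mat_def)
  finally show ?thesis
    unfolding cof using new det by (simp only: tunit_mult tunit_minus_1_power add_0_right)
qed

lemma tunit_alexander_entry_crossing_under:
  assumes "fst e \<noteq> z" and "l \<noteq> z"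
  shows "tunit (alexander_entry (crossing_under e l z) z)" "tunit (alexander_entry (crossing_under e z l) z)"
  using assms by (simp_all add: alexander_entry_def crossing_under_def tunit_tpow tunit_minus tunit_1)

lemma tunit_det_label_mat:
  assumes "rational_tangle T a b"
  shows "tunit (det (label_mat (crossings T)))"
proof -
  have "label_mat [] = mat 2 2 (\<lambda>(i, j). of_bool (i \<noteq> j))"
    by (auto simp: label_mat_def row_mat_def indicator_row_def numeral_2_eq_2 less_Suc_eq intro!: eq_matI)
  then have nil: "tunit (det (label_mat []))"
    by (simp add: det_mat_2_2 tunit_minus tunit_1)
  show ?thesis
    using assms
  proof (induction rule: rational_tangle.induct)
    case (3 T a b s)
    then show ?case
      using rational_tangle_arcs(3)[OF 3(1)] rational_tangle_fresh[OF 3(1)]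
      by (simp add: right_twist_def Let_def fresh_arc_def tunit_det_label_mat_Cons
        tunit_alexander_entry_crossing_under)
  next
    case (4 T a b s)
    then show ?case
      using rational_tangle_arcs(3)[OF 4(1)] rational_tangle_fresh[OF 4(1)]
      by (simp add: bottom_twist_def Let_def fresh_arc_def tunit_det_label_mat_Cons
        tunit_alexander_entry_crossing_under)
  next
    case (1 x y)
    then show ?case using nil by (simp add: zero_tangle_def)
  next
    case (2 x y)
    then show ?case using nil by (simp add: infinity_tangle_def)
  qed
qed

lemma rational_tangle_parity: "rational_tangle T a b \<Longrightarrow> odd a \<or> odd b"
  by (induction rule: rational_tangle.induct) (auto split: if_splits)

lemma rational_tangle_new_arcs:
  assumes "rational_tangle T a b" and "2 \<le> m" and "m < length (crossings T) + 2"
  shows "m \<in> (\<Union>x \<in> set (crossings T). crossing_arcs x)"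
  using assms
proof (induction rule: rational_tangle.induct)
  case (3 T a b s)
  then show ?case
    by (cases s; cases "m = fresh_arc T")
      (simp_all add: right_twist_def Let_def fresh_arc_def crossing_arcs_under)
next
  case (4 T a b s)
  then show ?case
    by (cases s; cases "m = fresh_arc T")
      (simp_all add: bottom_twist_def Let_def fresh_arc_def crossing_arcs_under)
qed (simp_all add: zero_tangle_def infinity_tangle_def)

definition closure_map :: "tangle \<Rightarrow> nat \<Rightarrow> nat" where
  "closure_map T = (let f = merge_arcs (fst (nw T)) (fst (ne T))
     in merge_arcs (f (fst (sw T))) (f (fst (se T))) \<circ> f)"

lemma numerator_closure_eq: "numerator_closure T = map (relabel (closure_map T)) (crossings T)"
  by (simp add: numerator_closure_def closure_map_def Let_def)

lemma length_numerator_closure: "length (numerator_closure T) = length (crossings T)"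
  by (simp add: numerator_closure_eq)

subsection \<open>Closure\<close>

locale closed_rational_tangle =
  fixes T a b
  assumes tangle: "rational_tangle T a b" and nonzero: "a \<noteq> 0" "b \<noteq> 0"
begin

abbreviation "c \<equiv> length (crossings T)"
abbreviation "h \<equiv> closure_map T"
abbreviation "e \<equiv> fst (ne T)"
abbreviation "w \<equiv> fst (sw T)"
abbreviation "d \<equiv> fst (se T)"

text \<open>The name of the SE arc once NE is merged into arc 0; \<open>e\<close> and
  \<open>d'\<close> are the two names that disappear in the closure.\<close>

definition "d' = merge_arcs 0 e d"

definition "cs = sorted_list_of_set ({..<c + 2} - {e, d'})"

lemma ends_less: "e < c + 2" "w < c + 2" "d < c + 2"
  using rational_tangle_arcs(2)[OF tangle] by (auto simp: tangle_ends_def)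

text \<open>Each coincidence of end arcs would equate two of the colours 0, a, b, a + b in a way
  that forces a = 0 or b = 0.\<close>

lemma ends_neq: "e \<noteq> 0" "w \<noteq> d" "\<not> (w = 0 \<and> d = e)" "\<not> (w = e \<and> d = 0)"
proof -
  obtain l :: "nat \<Rightarrow> int" where "l 0 = 0" "l e = a" "l w = b" "l d = a + b"
    using rational_tangle_coloring[OF tangle] by blast
  note l = this
  have *: "l e = a \<Longrightarrow> l d = a + b \<Longrightarrow> l w = b \<Longrightarrow> e = 0 \<or> w = d \<or> w = 0 \<and> d = e \<or> w = e \<and> d = 0 \<Longrightarrow> False"
    using l(1) nonzero by (elim disjE) simp_all
  from *[OF l(2,4,3)]
  show "e \<noteq> 0" "w \<noteq> d" "\<not> (w = 0 \<and> d = e)" "\<not> (w = e \<and> d = 0)"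
    by satx+
qed

lemma d'_less: "d' < c + 2" and e_neq_d': "e \<noteq> d'"
  using ends_less ends_neq by (auto simp: d'_def merge_arcs_def)

lemma h_simps: "h 0 = h e" "h w = h d" "m \<noteq> e \<Longrightarrow> m \<noteq> d' \<Longrightarrow> h m = m" "h d' = h w"
  using ends_neq rational_tangle_arcs(1)[OF tangle]
  by (auto simp: closure_map_def d'_def merge_arcs_def Let_def split: if_splits)

lemma h_range: "m < c + 2 \<Longrightarrow> h m \<in> {..<c + 2} - {e, d'}"
  using ends_neq ends_less rational_tangle_arcs(1)[OF tangle]
  by (auto simp: closure_map_def d'_def merge_arcs_def Let_def split: if_splits)

lemma length_cs: "length cs = c"
  using ends_less(1) d'_less e_neq_d' by (simp add: cs_def card_Diff_subset)

lemma set_cs: "set cs = {..<c + 2} - {e, d'}" and distinct_cs: "distinct cs"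
  by (simp_all add: cs_def)

text \<open>A surviving arc that meets no crossing is glued to one of the vanishing arcs. If that
  one met no crossing either, the two would be the arcs 0 and 1, against
  \<open>rational_tangle_base_arc\<close>.\<close>

lemma arcs_numerator_closure: "arcs (numerator_closure T) = cs"
proof -
  let ?U = "\<Union>x \<in> set (crossings T). crossing_arcs x"
  let ?S = "{..<c + 2} - {e, d'}"
  have U: "?U \<subseteq> {..<c + 2}" by (intro UN_least rational_tangle_arcs(3)[OF tangle])
  have nonempty: "crossings T \<noteq> []"
    using rational_tangle_base_arc[OF tangle] nonzero by auto
  have "x \<in> h ` ?U" if x: "x \<in> ?S" for x
  proof (cases "x \<in> ?U")
    case True
    moreover have "h x = x" using h_simps(3) x by simp
    ultimately show ?thesis using imageI[of x ?U h] by (simp only:)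
  next
    case False
    have "x \<in> tangle_ends T \<union> ?U"
      using rational_tangle_arc_cover[OF tangle] x by (elim subsetD DiffD1)
    then have "x \<in> tangle_ends T" using False by (simp only: Un_iff simp_thms)
    then have "x = 0 \<or> x = w \<or> x = d"
      using x rational_tangle_arcs(1)[OF tangle] by (auto simp: tangle_ends_def)
    moreover have "x \<noteq> d \<or> x = 0"
      using x by (auto simp: d'_def merge_arcs_def split: if_splits)
    ultimately have "x = 0 \<or> x = w" by auto
    then have "\<exists>x' \<in> {e, d'}. h x' = x"
      using h_simps(1,4) h_simps(3)[of x] x by auto
    then obtain x' where x': "x' \<in> {e, d'}" "h x' = x" ..
    have "x' \<in> ?U"
    proof (rule ccontr)
      assume x'_notin: "x' \<notin> ?U"
      have "x < c + 2" using x by simp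
      then have "\<not> 2 \<le> x" using rational_tangle_new_arcs[OF tangle] False by iprover
      moreover have "x' < c + 2" using x'(1) ends_less d'_less by (elim insertE emptyE) simp_all
      then have "\<not> 2 \<le> x'" using rational_tangle_new_arcs[OF tangle] x'_notin by iprover
      moreover have "x' \<noteq> x" using x'(1) x by auto
      ultimately have "x = 0 \<and> x' = 1 \<or> x = 1 \<and> x' = 0" by linarith
      then have "{0, 1} \<inter> ?U = {}" using False x'_notin by (elim disjE conjE) simp_all
      then show False using rational_tangle_base_arc[OF tangle] nonempty by (simp only: if_False simp_thms)
    qed
    then show ?thesis using x'(2) imageI[of x' ?U h] by (simp only:)
  qed
  moreover have "h ` ?U \<subseteq> ?S"
    using subsetD[OF U] by (intro image_subsetI h_range) (simp only: lessThan_iff)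
  ultimately have "h ` ?U = ?S" by (metis subset_antisym subsetI)
  moreover have "over ` set (numerator_closure T) \<union> left ` set (numerator_closure T) \<union>
      right ` set (numerator_closure T) = (\<Union>x \<in> set (crossings T). h ` crossing_arcs x)"
    by (auto simp: numerator_closure_eq crossing_arcs_def relabel_def image_image)
  ultimately show ?thesis by (simp only: arcs_def cs_def image_UN)
qed

lemma alexander_matrix_numerator_closure:
  "alexander_matrix (numerator_closure T) =
     row_mat c (\<lambda>i j. \<Sum>m<c + 2. alexander_entry (crossings T ! i) m * of_bool (h m = cs ! j))"
proof (rule eq_matI)
  fix i j
  assume "i < dim_row (row_mat c (\<lambda>i j. \<Sum>m<c + 2. alexander_entry (crossings T ! i) m * of_bool (h m = cs ! j)))"
    and "j < dim_col (row_mat c (\<lambda>i j. \<Sum>m<c + 2. alexander_entry (crossings T ! i) m * of_bool (h m = cs ! j)))"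
  then have ij: "i < c" "j < c" by (simp_all add: row_mat_def)
  then have "crossing_arcs (crossings T ! i) \<subseteq> {..<c + 2}"
    using rational_tangle_arcs(3)[OF tangle] by simp
  from sum_alexander_entry[OF this, of "\<lambda>m. of_bool (h m = cs ! j)"]
  have "alexander_entry (relabel h (crossings T ! i)) (cs ! j) =
      (\<Sum>m<c + 2. alexander_entry (crossings T ! i) m * of_bool (h m = cs ! j))"
    by (simp add: alexander_entry_indicator indicator_row_def relabel_def eq_commute[of "cs ! j"])
  then show "alexander_matrix (numerator_closure T) $$ (i, j) =
      row_mat c (\<lambda>i j. \<Sum>m<c + 2. alexander_entry (crossings T ! i) m * of_bool (h m = cs ! j)) $$ (i, j)"
    using ij unfolding alexander_matrix_def arcs_numerator_closure
    by (simp add: row_mat_def numerator_closure_eq length_cs del: sum.lessThan_Suc)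
qed (simp_all add: alexander_matrix_def arcs_numerator_closure row_mat_def length_numerator_closure length_cs)

text \<open>Opposite directions at NW and NE make the two letters cancel in the prefix, so their
  weights are opposite; likewise at SE and SW.\<close>

lemma boundary_closable:
  assumes "closable T"
  shows "\<exists>v u. tunit u \<and> (\<forall>m. boundary T m =
    - (v * (indicator_row 0 m - indicator_row e m)) - u * (indicator_row w m - indicator_row d m))"
proof -
  define g where "g = advance (snd (ne T)) (advance (snd (nw T)) 1)"
  have "boundary T m =
      - (- weight (snd (nw T)) 1 * (indicator_row 0 m - indicator_row e m))
      - weight (snd (se T)) g * (indicator_row w m - indicator_row d m)" for m
    using assms rational_tangle_arcs(1)[OF tangle]
    unfolding boundary_def end_weights_def closable_def g_def
    by (cases "snd (nw T)"; cases "snd (ne T)"; cases "snd (sw T)"; cases "snd (se T)")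
      (simp_all add: Let_def weight_def advance_def tau_cancel algebra_simps)
  moreover have "tunit (weight (snd (se T)) g)"
    by (simp add: g_def tunit_weight tunit_advance tunit_1)
  ultimately show ?thesis by blast
qed

lemma det_mat_delete_alexander_matrix:
  assumes closable: "closable T" and ij: "i < c" "j < c"
    and l: "l 0 = 0" "l 1 = 1"
      "\<And>x. x \<in> set (crossings T) \<Longrightarrow> (1 - tpow 1) * l (over x) + tpow 1 * l (left x) - l (right x) = 0"
  shows "det (mat_delete (alexander_matrix (numerator_closure T)) i j) \<doteq> l e"
proof -
  let ?N = "\<lambda>k. alexander_entry (crossings T ! k)"
  let ?f = "\<lambda>m. of_bool (m = 0) - of_bool (m = e) :: int"
  let ?g = "\<lambda>m. of_bool (m = w) - of_bool (m = d) :: int"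
  have delta: "(\<Sum>m<c + 2. (of_bool (m = x) - of_bool (m = y)) * z m) = z x - z y"
    if "x < c + 2" "y < c + 2" for x y and z :: "nat \<Rightarrow> int"
  proof -
    have "(\<Sum>m<c + 2. (of_bool (m = x) - of_bool (m = y)) * z m) =
        (\<Sum>m<c + 2. (if m = x then z m else 0) - (if m = y then z m else 0))"
      by (rule sum.cong) auto
    then show ?thesis using that by (simp add: sum_subtractf del: sum.lessThan_Suc)
  qed
  have f: "(\<Sum>m<c + 2. ?f m * of_bool (h m = cs ! k)) = 0" for k
    using delta[of 0 e "\<lambda>m. of_bool (h m = cs ! k)"] ends_less h_simps(1) by simp
  have g: "(\<Sum>m<c + 2. ?g m * of_bool (h m = cs ! k)) = 0" for k
    using delta[of w d "\<lambda>m. of_bool (h m = cs ! k)"] ends_less h_simps(2) by simp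
  \<comment> \<open>For \<open>d\<close> different from \<open>e\<close> the product of the diagonal
    values -1 gives 1; for \<open>d = e\<close>, where \<open>d'\<close> is 0, the off-diagonal
    values 1 and -1 do. \<open>ends_neq\<close> makes the other product vanish.\<close>
  have fg: "?f e * ?g d' - ?f d' * ?g e = 1"
    using ends_neq by (auto simp: d'_def merge_arcs_def)
  have "det (mat_delete (alexander_matrix (numerator_closure T)) i j) \<doteq>
      det (row_mat (c + 2) ((?N(c := (\<lambda>m. of_int (?f m)), Suc c := (\<lambda>m. of_int (?g m))))
        (i := indicator_row (cs ! j))))"
    unfolding alexander_matrix_numerator_closure
    by (rule det_mat_delete_quotient[OF f g ends_less(1) d'_less fg length_cs distinct_cs _ ij])
      (use set_cs h_simps(3) in auto)
  also have "(\<lambda>m. of_int (?f m)) = (\<lambda>m. indicator_row 0 m - indicator_row e m)"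
    by (simp add: indicator_row_def)
  also have "(\<lambda>m. of_int (?g m)) = (\<lambda>m. indicator_row w m - indicator_row d m)"
    by (simp add: indicator_row_def)
  finally have quotient: "det (mat_delete (alexander_matrix (numerator_closure T)) i j) \<doteq>
      det (row_mat (c + 2) ((?N(c := (\<lambda>m. indicator_row 0 m - indicator_row e m),
        Suc c := (\<lambda>m. indicator_row w m - indicator_row d m)))(i := indicator_row (cs ! j))))" .
  obtain y where y: "\<And>k. k < c \<Longrightarrow> tunit (y k)" "\<And>m. (\<Sum>k<c. y k * ?N k m) = boundary T m"
    using rational_tangle_boundary[OF tangle] by blast
  obtain v u where vu: "tunit u" "\<And>m. boundary T m =
      - (v * (indicator_row 0 m - indicator_row e m)) - u * (indicator_row w m - indicator_row d m)"
    using boundary_closable[OF closable] by blast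
  have arcs: "crossing_arcs (crossings T ! k) \<subseteq> {..<c + 2}" if "k < c" for k
    using rational_tangle_arcs(3)[OF tangle nth_mem[OF that]] .
  have "cs ! j < c + 2" using set_cs nth_mem[of j cs] ij length_cs by auto
  then have "det (row_mat (c + 2) ((?N(c := (\<lambda>m. indicator_row 0 m - indicator_row e m),
        Suc c := (\<lambda>m. indicator_row w m - indicator_row d m)))(i := indicator_row (cs ! j)))) \<doteq> l e"
  proof (intro det_relation_rows[of c ?N l y u v])
    show "(\<Sum>m<c + 2. ?N k m) = 0" if "k < c" for k
      using sum_alexander_entry[OF arcs[OF that], of "\<lambda>_. 1"] by (simp del: sum.lessThan_Suc)
    show "(\<Sum>m<c + 2. ?N k m * l m) = 0" if "k < c" for k
      using sum_alexander_entry[OF arcs[OF that], of l] l(3)[OF nth_mem[OF that]] by simp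
    show "tunit (det (row_mat (c + 2) (?N(c := indicator_row 1, Suc c := indicator_row 0))))"
      using tunit_det_label_mat[OF tangle] by (simp add: label_mat_def)
  qed (use y vu l ij ends_less in simp_all)
  with quotient show ?thesis by (rule unit_equiv_trans)
qed

text \<open>All minors agree with \<open>l e\<close> up to units, whichever row and column are
  deleted; a crossing exists, so there is at least one minor.\<close>

lemma is_alexander_polynomial_numerator_closure:
  assumes closable: "closable T"
    and l: "l 0 = 0" "l 1 = 1"
      "\<And>x. x \<in> set (crossings T) \<Longrightarrow> (1 - tpow 1) * l (over x) + tpow 1 * l (left x) - l (right x) = 0"
  shows "is_alexander_polynomial (numerator_closure T) \<Delta> \<longleftrightarrow> \<Delta> \<doteq> l e"
proof -
  have dim: "dim_row (alexander_matrix (numerator_closure T)) = c"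
    "dim_col (alexander_matrix (numerator_closure T)) = c"
    by (simp_all add: alexander_matrix_numerator_closure row_mat_def)
  have det: "det (mat_delete (alexander_matrix (numerator_closure T)) i j) \<doteq> l e" if "i < c" "j < c" for i j
    using det_mat_delete_alexander_matrix[OF closable that l] .
  have "0 < c" using rational_tangle_base_arc[OF tangle] nonzero by auto
  then show ?thesis
    unfolding is_alexander_polynomial_def dim
    using unit_equiv_trans[OF _ det] unit_equiv_trans[OF _ unit_equiv_sym[OF det]] by blast
qed

end

theorem theorem3:
  fixes p q :: int and n :: nat and k :: "nat \<Rightarrow> int" and D :: diagram and \<Delta> :: laurent
  assumes "p > q" and "q > 0" and "coprime p q" and "even q"
    and "n \<ge> 1" and "\<And>i. i \<in> {1..2 * n} \<Longrightarrow> k i \<noteq> 0"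
    and "of_int p / of_int q = cfrac (map (\<lambda>i. 2 * k i) [1..<2 * n + 1])"
    and "rational_knot_diagram p q D"
  shows "is_alexander_polynomial D \<Delta> \<longleftrightarrow>
    \<Delta> \<doteq> continuant (map (\<lambda>i. if odd i then qint 2 (- tpow 1) * of_int (k i)
                              else - qint 2 (- tpow (- 1)) * of_int (k i)) [1..<2 * n + 1])"
proof -
  define ks where "ks = map (\<lambda>i. (k (2 * i + 1), k (2 * i + 2))) [0..<n]"
  have nz: "nonzero_pairs ks" and "ks \<noteq> []"
    using assms(5,6) by (auto simp: nonzero_pairs_def ks_def)
  have "map (\<lambda>i. 2 * k i) [1..<2 * n + 1] = concat (map (\<lambda>(k, l). [2 * k, 2 * l]) ks)"
    using map_upt_pairs[of "\<lambda>x. 2 * x" k "\<lambda>x. 2 * x" n] by (simp add: ks_def)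
  then have pq: "of_int p / of_int q = (of_int (fst (even_cfrac ks)) / of_int (snd (even_cfrac ks)) :: rat)"
    using cfrac_pairs[OF nz \<open>ks \<noteq> []\<close>] assms(7) by simp
  have cont: "continuant (map (\<lambda>i. if odd i then qint 2 (- tpow 1) * of_int (k i)
      else - qint 2 (- tpow (- 1)) * of_int (k i)) [1..<2 * n + 1]) =
      (- 1) ^ length ks * fst (label_cfrac False ks)"
    unfolding map_upt_pairs[of "\<lambda>x. qint 2 (- tpow 1) * of_int x" k
      "\<lambda>x. - qint 2 (- tpow (- 1)) * of_int x" n] ks_def[symmetric]
    by (rule continuant_label_cfrac)
  obtain T a b where T: "rational_tangle T a b" "b \<noteq> 0"
    "(of_int a / of_int b :: rat) = of_int p / of_int q" "closable T" "D = numerator_closure T"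
    using assms(8) by (auto simp: rational_knot_diagram_def)
  have "a \<noteq> 0" using T(2,3) assms(1,2) by auto
  interpret closed_rational_tangle T a b
    by unfold_locales (fact T(1) \<open>a \<noteq> 0\<close> T(2))+
  have "(of_int (a * q) :: rat) = of_int (b * p)"
    using T(2,3) assms(2) by (simp add: field_simps)
  then have aq: "a * q = b * p" by (simp only: of_int_eq_iff)
  \<comment> \<open>The tangle may have a different numerator and denominator than \<open>p\<close>
    and \<open>q\<close>; the parity of \<open>b\<close> follows from \<open>a * q = b * p\<close>,
    and that of \<open>a\<close> because twists never make both even.\<close>
  have "odd p" using assms(3,4) coprime_common_divisor[of p q 2] by auto
  moreover have "even (b * p)" using aq assms(4) by (simp flip: aq)
  ultimately have "even b" by simp
  then have "odd a" using rational_tangle_parity[OF T(1)] by blast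
  obtain l where l: "l 0 = 0" "l 1 = 1"
    "\<And>x. x \<in> set (crossings T) \<Longrightarrow> (1 - tpow 1) * l (over x) + tpow 1 * l (left x) - l (right x) = 0"
    "reachable (tangle_state T l) a b"
    using rational_tangle_labels[OF T(1)] by blast
  have flags: "nw_out (tangle_state T l) \<noteq> ne_out (tangle_state T l)"
    "sw_out (tangle_state T l) \<noteq> se_out (tangle_state T l)"
    using T(4) by (simp_all add: tangle_state_def closable_def)
  obtain c u ks' where ks': "tunit u" "reduced ks'"
    "tangle_state T l = scale u (closed_state c (label_cfrac c ks'))"
    "a * snd (even_cfrac ks') = b * fst (even_cfrac ks')"
    using reachable_closed_state[OF l(4) \<open>odd a\<close> \<open>even b\<close> flags] by (elim exE conjE)
  have "snd (even_cfrac ks) \<noteq> 0" using pq assms(1,2) by auto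
  then have "(of_int (a * snd (even_cfrac ks)) :: rat) = of_int (b * fst (even_cfrac ks))"
    using T(2,3) pq by (simp add: field_simps)
  then have ab: "a * snd (even_cfrac ks) = b * fst (even_cfrac ks)" by (simp only: of_int_eq_iff)
  \<comment> \<open>Both lists represent the fraction \<open>a / b\<close>; cancelling
    \<open>b\<close> gives the equality of values that uniqueness requires.\<close>
  have "b * (fst (even_cfrac ks') * snd (even_cfrac ks)) = (a * snd (even_cfrac ks')) * snd (even_cfrac ks)"
    by (simp only: ks'(4) mult.assoc)
  also have "\<dots> = (a * snd (even_cfrac ks)) * snd (even_cfrac ks')"
    by (simp only: mult.assoc mult.commute mult.left_commute)
  also have "\<dots> = b * (fst (even_cfrac ks) * snd (even_cfrac ks'))"
    by (simp only: ab mult.assoc)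
  finally have "ks' = ks"
    using reduced_unique[OF ks'(2) nonzero_pairs_reduced[OF nz]] T(2) by simp
  then have "l e = u * fst (label_cfrac c ks)"
    using ks'(3) by (cases "label_cfrac c ks") (simp add: tangle_state_def)
  also have "fst (label_cfrac c ks) = fst (label_cfrac False ks)"
    using label_cfrac_swap[of ks] by (cases c) simp_all
  also have "u * \<dots> = (u * (- 1) ^ length ks) * ((- 1) ^ length ks * fst (label_cfrac False ks))"
    by (cases "even (length ks)") simp_all
  finally have equiv: "l e \<doteq> (- 1) ^ length ks * fst (label_cfrac False ks)"
    by (rule unit_equivI[rotated]) (intro tunit_mult ks'(1) tunit_minus_1_power)
  have "is_alexander_polynomial D \<Delta> \<longleftrightarrow> \<Delta> \<doteq> l e"
    unfolding T(5) by (rule is_alexander_polynomial_numerator_closure[OF T(4) l(1,2)]) (rule l(3))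
  also have "\<dots> \<longleftrightarrow> \<Delta> \<doteq> (- 1) ^ length ks * fst (label_cfrac False ks)"
    using unit_equiv_trans[OF _ equiv] unit_equiv_trans[OF _ unit_equiv_sym[OF equiv]] by iprover
  finally show ?thesis unfolding cont .
qed

end
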